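(* Let $X\subseteq\mathbb{C}$ be compact, perfect and the union of finitely many pointwise regular sets. Let $L>0$, and let $\mathcal{F}$ be a useful set of paths in $X$ which includes all injective rectifiable paths in $X$ with length $\le L$. Then $D^1(X)=\mathcal{D}^1_{\mathcal{F}}(X)$ (and hence $D^1(X)$ is complete).
   Context: Perfect means non-empty without isolated points. A function $f:X\to\mathbb{C}$ is complex-differentiable at $a\in X$ if $f'(a)=\lim_{z\to a,\,z\in X\setminus\{a\}}\frac{f(z)-f(a)}{z-a}$ exists. $D^1(X)$ is the space of continuously complex-differentiable functions on $X$, with norm $\|f\|=\|f\|_\infty+\|f'\|_\infty$ (supremum norms on $X$). A path in $X$ is a continuous map $\gamma:[a,b]\to X$ with $a<b$ real; its endpoints are $\gamma^-=\gamma(a)$ and $\gamma^+=\gamma(b)$, and $|\gamma|$ denotes the length of a rectifiable path. A Jordan arc is an injective path. A set $\mathcal{F}$ of paths in $X$ is useful if every path in $\mathcal{F}$ is a rectifiable Jordan arc and, whenever $\gamma\in\mathcal{F}$ is defined on $[a,b]$ and $[c,d]\subseteq[a,b]$ with $c<d$, the restriction of $\gamma$ to $[c,d]$ is in $\mathcal{F}$. A compact set $Y\subseteq\mathbb{C}$ is pointwise regular if it has more than one point and for every $z\in Y$ there is $k_z>0$ such that for every $w\in Y$ there is a rectifiable path $\gamma$ in $Y$ from $z$ to $w$ with $|\gamma|\le k_z|z-w|$. For $f\in C(X)$ (continuous complex-valued functions on $X$), a function $g\in C(X)$ is an $\mathcal{F}$-derivative of $f$ if $\int_\gamma g(z)\,dz=f(\gamma^+)-f(\gamma^-)$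 for every $\gamma\in\mathcal{F}$. $\mathcal{D}^1_{\mathcal{F}}(X)$ is the set of $f\in C(X)$ which have an $\mathcal{F}$-derivative in $C(X)$. *)

theory Defs
  imports "HOL-Analysis.Analysis"
begin

definition perfect :: "complex set \<Rightarrow> bool" where
  "perfect X \<longleftrightarrow> X \<noteq> {} \<and> (\<forall>x\<in>X. \<not> x isolated_in X)"


subsection \<open>Function spaces\<close>

text \<open>A function \<open>X \<rightarrow> \<complex>\<close> is a HOL function that is \<open>undefined\<close> outside \<open>X\<close>, so that two
  elements of a function space are equal iff they agree on \<open>X\<close>.\<close>

definition C_fun :: "complex set \<Rightarrow> (complex \<Rightarrow> complex) set" where
  "C_fun X = {f \<in> extensional X. continuous_on X f}"

text \<open>The library's \<open>deriv\<close> uses the filter \<open>at a\<close>, not \<open>at a within X\<close>.\<close>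

definition cderiv :: "complex set \<Rightarrow> (complex \<Rightarrow> complex) \<Rightarrow> complex \<Rightarrow> complex" where
  "cderiv X f a = Lim (at a within X) (\<lambda>z. (f z - f a) / (z - a))"

definition D1 :: "complex set \<Rightarrow> (complex \<Rightarrow> complex) set" where
  "D1 X = {f \<in> extensional X.
     (\<forall>a\<in>X. f field_differentiable (at a within X)) \<and> continuous_on X (cderiv X f)}"

definition sup_norm :: "complex set \<Rightarrow> (complex \<Rightarrow> complex) \<Rightarrow> real" where
  "sup_norm X f = (SUP z\<in>X. norm (f z))"

definition D1_norm :: "complex set \<Rightarrow> (complex \<Rightarrow> complex) \<Rightarrow> real" where
  "D1_norm X f = sup_norm X f + sup_norm X (cderiv X f)"

text \<open>The case distinction is needed because the locale \<open>Metric_space\<close> requires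
  distances to be nonnegative also outside the carrier.\<close>

definition D1_dist :: "complex set \<Rightarrow> (complex \<Rightarrow> complex) \<Rightarrow> (complex \<Rightarrow> complex) \<Rightarrow> real" where
  "D1_dist X f g =
     (if f \<in> D1 X \<and> g \<in> D1 X then D1_norm X (\<lambda>z\<in>X. f z - g z) else 0)"


subsection \<open>Paths\<close>

text \<open>The triple \<open>(a, b, \<gamma>)\<close> is the path \<open>\<gamma> : [a,b] \<rightarrow> \<complex>\<close>, with \<open>\<gamma>\<close> being \<open>undefined\<close>
  outside \<open>[a,b]\<close>.\<close>

type_synonym cpath = "real \<times> real \<times> (real \<Rightarrow> complex)"

definition path_in :: "complex set \<Rightarrow> cpath \<Rightarrow> bool" where
  "path_in X = (\<lambda>(a, b, \<gamma>). a < b \<and> \<gamma> \<in> extensional {a..b} \<and>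
     continuous_on {a..b} \<gamma> \<and> \<gamma> ` {a..b} \<subseteq> X)"

definition start_pt :: "cpath \<Rightarrow> complex" where
  "start_pt = (\<lambda>(a, b, \<gamma>). \<gamma> a)"

definition end_pt :: "cpath \<Rightarrow> complex" where
  "end_pt = (\<lambda>(a, b, \<gamma>). \<gamma> b)"

definition injective_path :: "cpath \<Rightarrow> bool" where
  "injective_path = (\<lambda>(a, b, \<gamma>). inj_on \<gamma> {a..b})"

definition restrict_path :: "cpath \<Rightarrow> real \<Rightarrow> real \<Rightarrow> cpath" where
  "restrict_path = (\<lambda>(a, b, \<gamma>) c d. (c, d, restrict \<gamma> {c..d}))"

text \<open>Lengths of inscribed polygons; a partition \<open>a = t\<^sub>0 \<le> \<dots> \<le> t\<^sub>n = b\<close> is given as a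
  division of \<open>[a,b]\<close> into the intervals \<open>[t\<^sub>i, t\<^sub>i\<^sub>+\<^sub>1]\<close>.\<close>

definition polygon_lengths :: "cpath \<Rightarrow> real set" where
  "polygon_lengths = (\<lambda>(a, b, \<gamma>).
     {\<Sum>K\<in>\<D>. norm (\<gamma> (Sup K) - \<gamma> (Inf K)) |\<D>. \<D> division_of {a..b}})"

definition rectifiable :: "cpath \<Rightarrow> bool" where
  "rectifiable p \<longleftrightarrow> bdd_above (polygon_lengths p)"

definition path_len :: "cpath \<Rightarrow> real" where
  "path_len p = Sup (polygon_lengths p)"

text \<open>The Riemann--Stieltjes integral along a path. The library's \<open>has_contour_integral\<close> is not
  suitable, since it needs the path to be (piecewise) differentiable.\<close>

definition has_path_integral :: "(complex \<Rightarrow> complex) \<Rightarrow> complex \<Rightarrow> cpath \<Rightarrow> bool" where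
  "has_path_integral g I = (\<lambda>(a, b, \<gamma>).
     \<forall>\<epsilon>>0. \<exists>\<delta>>0. \<forall>p. p tagged_division_of {a..b} \<and> (\<forall>(t, K)\<in>p. Sup K - Inf K < \<delta>) \<longrightarrow>
       norm ((\<Sum>(t, K)\<in>p. g (\<gamma> t) * (\<gamma> (Sup K) - \<gamma> (Inf K))) - I) < \<epsilon>)"

definition useful :: "complex set \<Rightarrow> cpath set \<Rightarrow> bool" where
  "useful X \<F> \<longleftrightarrow>
     (\<forall>p\<in>\<F>. path_in X p \<and> rectifiable p \<and> injective_path p) \<and>
     (\<forall>a b \<gamma> c d. (a, b, \<gamma>) \<in> \<F> \<and> a \<le> c \<and> c < d \<and> d \<le> b \<longrightarrow>
        restrict_path (a, b, \<gamma>) c d \<in> \<F>)"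

definition pointwise_regular :: "complex set \<Rightarrow> bool" where
  "pointwise_regular Y \<longleftrightarrow> compact Y \<and> (\<exists>z\<in>Y. \<exists>w\<in>Y. z \<noteq> w) \<and>
     (\<forall>z\<in>Y. \<exists>k>0. \<forall>w\<in>Y. \<exists>p. path_in Y p \<and> rectifiable p \<and>
        start_pt p = z \<and> end_pt p = w \<and> path_len p \<le> k * norm (z - w))"


subsection \<open>Derivatives along a set of paths\<close>

definition F_derivative ::
    "complex set \<Rightarrow> cpath set \<Rightarrow> (complex \<Rightarrow> complex) \<Rightarrow> (complex \<Rightarrow> complex) \<Rightarrow> bool" where
  "F_derivative X \<F> f g \<longleftrightarrow> g \<in> C_fun X \<and>
     (\<forall>p\<in>\<F>. has_path_integral g (f (end_pt p) - f (start_pt p)) p)"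

definition D1F :: "complex set \<Rightarrow> cpath set \<Rightarrow> (complex \<Rightarrow> complex) set" where
  "D1F X \<F> = {f \<in> C_fun X. \<exists>g. F_derivative X \<F> f g}"

end

theory Submission
  imports Defs
begin

text \<open>If \<open>f\<close> is differentiable on \<open>X\<close>, then near each parameter the increments of \<open>f \<circ> \<gamma>\<close> are
  controlled by those of the variation function of \<open>\<gamma>\<close>, and Cousin's lemma turns this local control
  into the fundamental theorem of calculus along an arbitrary rectifiable path. Conversely, let \<open>g\<close> be
  an \<open>\<F>\<close>-derivative of \<open>f\<close>. A point \<open>w\<close> close to \<open>z\<close> in the same pointwise regular set is
  joined to \<open>z\<close> by a path of length at most \<open>k |w - z|\<close>. The image of that path contains an arc
  between the same endpoints, and such an arc is no longer than the path, hence belongs to \<open>\<F>\<close>.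
  Integrating \<open>g - g z\<close> along it shows that \<open>f\<close> has derivative \<open>g z\<close> at \<open>z\<close>. Completeness follows
  because \<open>\<F>\<close>-derivatives survive uniform limits.\<close>

section \<open>Length of rectifiable paths through divisions of the parameter interval\<close>

abbreviation chord :: "(real \<Rightarrow> complex) \<Rightarrow> real set \<Rightarrow> real" where
  "chord \<gamma> K \<equiv> norm (\<gamma> (Sup K) - \<gamma> (Inf K))"

lemma division_of_realE:
  fixes K S :: "real set"
  assumes "D division_of S" "K \<in> D"
  obtains c d where "K = {c..d}" "c \<le> d"
  using division_ofD(3,4)[OF assms] by (metis atLeastatMost_empty_iff box_real(2) linorder_not_le)

lemma path_len_ge_division:
  assumes "rectifiable (a, b, \<gamma>)" "D division_of {a..b}"
  shows "(\<Sum>K\<in>D. chord \<gamma> K) \<le> path_len (a, b, \<gamma>)"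
  unfolding path_len_def
  by (rule cSup_upper) (use assms in \<open>auto simp: rectifiable_def polygon_lengths_def\<close>)

text \<open>A division of a part of \<open>{a..b}\<close> extends to one of the whole interval, and
  the added chords are nonnegative. Later lower bounds on length can therefore work with intervals
  that leave gaps.\<close>

lemma path_len_ge_partial_division:
  assumes "rectifiable (a, b, \<gamma>)" "D division_of S" "S \<subseteq> {a..b}"
  shows "(\<Sum>K\<in>D. chord \<gamma> K) \<le> path_len (a, b, \<gamma>)"
proof -
  have "\<Union>D \<subseteq> cbox a b"
    using assms division_ofD(6) by (metis box_real(2))
  then obtain E where E: "D \<subseteq> E" "E division_of {a..b}"
    using partial_division_extend_interval[of D a b] assms(2) by (metis box_real(2) division_of_union_self)
  have "(\<Sum>K\<in>D. chord \<gamma> K) \<le> (\<Sum>K\<in>E. chord \<gamma> K)"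
    by (rule sum_mono2) (use E division_ofD(1) in auto)
  also have "\<dots> \<le> path_len (a, b, \<gamma>)"
    by (rule path_len_ge_division) (use assms E in auto)
  finally show ?thesis .
qed

lemma polygon_lengths_nonempty: "a \<le> b \<Longrightarrow> polygon_lengths (a, b, \<gamma>) \<noteq> {}"
  unfolding polygon_lengths_def using division_of_self[of a b] by auto

lemma path_len_le:
  assumes "a \<le> b" "\<And>D. D division_of {a..b} \<Longrightarrow> (\<Sum>K\<in>D. chord \<gamma> K) \<le> B"
  shows "rectifiable (a, b, \<gamma>)" "path_len (a, b, \<gamma>) \<le> B"
proof -
  have B: "x \<le> B" if "x \<in> polygon_lengths (a, b, \<gamma>)" for x
    using that assms(2) by (auto simp: polygon_lengths_def)
  show "rectifiable (a, b, \<gamma>)"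
    using B by (auto simp: rectifiable_def bdd_above_def)
  show "path_len (a, b, \<gamma>) \<le> B"
    unfolding path_len_def by (rule cSup_least) (use B assms(1) polygon_lengths_nonempty in auto)
qed

lemma path_len_nonneg:
  assumes "rectifiable (a, b, \<gamma>)" "a \<le> b"
  shows "0 \<le> path_len (a, b, \<gamma>)"
proof -
  have "{{a..b}} division_of {a..b}"
    using division_of_self[of a b] assms(2) by auto
  from path_len_ge_division[OF assms(1) this] show ?thesis
    by (rule order_trans[rotated]) (simp add: sum_nonneg)
qed

lemma rectifiable_initial:
  assumes "rectifiable (a, b, \<gamma>)" "a \<le> t" "t \<le> b"
  shows "rectifiable (a, t, \<gamma>)"
proof (rule path_len_le(1))
  fix D assume "D division_of {a..t}"
  then show "(\<Sum>K\<in>D. chord \<gamma> K) \<le> path_len (a, b, \<gamma>)"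
    by (rule path_len_ge_partial_division[OF assms(1)]) (use assms in auto)
qed (use assms in auto)

text \<open>Appending \<open>{c..d}\<close> to a division of \<open>{a..c}\<close> gives a division
  of \<open>{a..d}\<close>; then pass to the supremum over the former. The length of the initial
  segment, as a function of its end, is thus a real function whose increments dominate those of
  \<open>\<gamma>\<close>.\<close>

lemma path_len_initial_increment:
  assumes "rectifiable (a, b, \<gamma>)" "a \<le> c" "c \<le> d" "d \<le> b"
  shows "norm (\<gamma> d - \<gamma> c) \<le> path_len (a, d, \<gamma>) - path_len (a, c, \<gamma>)"
proof -
  have rd: "rectifiable (a, d, \<gamma>)"
    using rectifiable_initial assms by auto
  have "path_len (a, c, \<gamma>) \<le> path_len (a, d, \<gamma>) - norm (\<gamma> d - \<gamma> c)"
  proof (rule path_len_le(2))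
    fix D assume D: "D division_of {a..c}"
    have cd: "{{c..d}} division_of {c..d}"
      using division_of_self[of c d] assms by auto
    have "interior {a..c} \<inter> interior {c..d} = {}"
      by (simp add: interior_atLeastAtMost_real)
    then have DU: "D \<union> {{c..d}} division_of {a..c} \<union> {c..d}"
      using division_disjoint_union[OF D cd] by simp
    have "(\<Sum>K\<in>D. chord \<gamma> K) + norm (\<gamma> d - \<gamma> c) = (\<Sum>K\<in>D \<union> {{c..d}}. chord \<gamma> K)"
    \<comment> \<open>The union would count an interval already in \<open>D\<close> only once; in
      that case \<open>c = d\<close> and its chord is zero.\<close>
    proof (cases "{c..d} \<in> D")
      case True
      then have "{c..d} \<subseteq> {a..c}" using division_ofD(2)[OF D] by blast
      then have "c = d" using assms by auto
      then show ?thesis using True by (simp add: insert_absorb)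
    next
      case False
      then show ?thesis using division_ofD(1)[OF D] assms by simp
    qed
    also have "\<dots> \<le> path_len (a, d, \<gamma>)"
      by (rule path_len_ge_partial_division[OF rd DU]) (use assms in auto)
    finally show "(\<Sum>K\<in>D. chord \<gamma> K) \<le> path_len (a, d, \<gamma>) - norm (\<gamma> d - \<gamma> c)"
      by simp
  qed (use assms in auto)
  then show ?thesis by simp
qed

text \<open>Shrinking each piece to the interval between its two chosen points leaves a partial
  division of \<open>{a..b}\<close>. This is what bounds a sum of diameters of pieces by the length,
  since each diameter is attained at two parameters.\<close>

lemma path_len_ge_chords:
  assumes "rectifiable (a, b, \<gamma>)" "D division_of {a..b}"
    and "\<And>K. K \<in> D \<Longrightarrow> s K \<in> K" "\<And>K. K \<in> D \<Longrightarrow> t K \<in> K"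
  shows "(\<Sum>K\<in>D. norm (\<gamma> (t K) - \<gamma> (s K))) \<le> path_len (a, b, \<gamma>)"
proof -
  define J where "J K = {min (s K) (t K)..max (s K) (t K)}" for K
  have sub: "J K \<subseteq> K" if K: "K \<in> D" for K
  proof -
    obtain c d where "K = {c..d}" using division_of_realE[OF assms(2) K] by blast
    then show ?thesis using assms(3,4)[OF K] by (auto simp: J_def)
  qed
  have disj: "interior (J K) \<inter> interior (J K') = {}" if "K \<in> D" "K' \<in> D" "K \<noteq> K'" for K K'
    using division_ofD(5)[OF assms(2) that] interior_mono[OF sub] that by blast
  have chord: "chord \<gamma> (J K) = norm (\<gamma> (t K) - \<gamma> (s K))" for K
    by (cases "s K \<le> t K") (simp_all add: J_def max_def min_def norm_minus_commute)
  have div: "J ` D division_of \<Union>(J ` D)"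
  proof (rule division_ofI)
    show "finite (J ` D)" using division_ofD(1)[OF assms(2)] by simp
    fix A B assume AB: "A \<in> J ` D" "B \<in> J ` D" "A \<noteq> B"
    then show "interior A \<inter> interior B = {}" using disj by blast
  next
    fix A assume A: "A \<in> J ` D"
    show "A \<noteq> {}" using A by (auto simp: J_def)
    show "\<exists>a b. A = cbox a b" using A by (auto simp: J_def)
  qed auto
  \<comment> \<open>\<open>J\<close> need not be injective on \<open>D\<close>: two pieces may
    shrink to the same interval. Disjointness of interiors makes such an interval a single point,
    whose chord vanishes.\<close>
  have "(\<Sum>A\<in>J ` D. chord \<gamma> A) = (\<Sum>K\<in>D. (chord \<gamma> \<circ> J) K)"
  proof (rule sum.reindex_nontrivial)
    show "finite D" using division_ofD(1)[OF assms(2)] .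
    fix K K' assume "K \<in> D" "K' \<in> D" "K \<noteq> K'" "J K = J K'"
    then have "interior (J K) = {}" using disj by fastforce
    then have "min (s K) (t K) = max (s K) (t K)"
      by (simp add: J_def interior_atLeastAtMost_real)
    then show "chord \<gamma> (J K) = 0" by (simp add: J_def)
  qed
  then have "(\<Sum>K\<in>D. norm (\<gamma> (t K) - \<gamma> (s K))) = (\<Sum>A\<in>J ` D. chord \<gamma> A)"
    by (simp add: chord)
  also have "\<dots> \<le> path_len (a, b, \<gamma>)"
    by (rule path_len_ge_partial_division[OF assms(1) div])
      (use sub division_ofD(2)[OF assms(2)] in blast)
  finally show ?thesis .
qed

section \<open>Arcs inside the image of a rectifiable path\<close>

text \<open>Project to the real line by the distance from \<open>x\<close>. The image of the
  connected set \<open>A\<close> contains the whole interval from 0 to \<open>dist x y\<close>, and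
  each \<open>B j\<close> projects into an interval no longer than its diameter, so subadditivity of
  Lebesgue measure gives the bound.\<close>

lemma dist_le_sum_diameter:
  fixes A :: "'a::metric_space set"
  assumes "connected A" "x \<in> A" "y \<in> A" "finite I" "A \<subseteq> (\<Union>j\<in>I. B j)"
    and "\<And>j. j \<in> I \<Longrightarrow> bounded (B j)"
  shows "dist x y \<le> (\<Sum>j\<in>I. diameter (B j))"
proof -
  \<comment> \<open>Empty sets \<open>B j\<close> are discarded, because the endpoints of
    \<open>F j\<close> would be \<open>Inf {}\<close> and \<open>Sup {}\<close>.\<close>
  define I' where "I' = {j\<in>I. B j \<noteq> {}}"
  define F where "F j = {Inf (dist x ` B j)..Sup (dist x ` B j)}" for j
  have I': "finite I'" using assms(4) by (simp add: I'_def)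
  have bd: "bounded (dist x ` B j)" if j: "j \<in> I" for j
  proof -
    obtain e where "\<forall>z\<in>B j. dist x z \<le> e"
      using assms(6)[OF j] bounded_any_center[of "B j" x] by blast
    then show ?thesis by (auto simp: bounded_real)
  qed
  have F1: "dist x z \<in> F j" if "j \<in> I" "z \<in> B j" for j z
    unfolding F_def using that bd[OF that(1)]
    by (auto intro!: cInf_lower cSup_upper bounded_imp_bdd_above bounded_imp_bdd_below)
  have F2: "measure lborel (F j) \<le> diameter (B j)" if "j \<in> I'" for j
  proof -
    have ne: "dist x ` B j \<noteq> {}" and j: "j \<in> I" using that by (auto simp: I'_def)
    have "Sup (dist x ` B j) \<le> Inf (dist x ` B j) + diameter (B j)"
    proof (rule cSup_least[OF ne])
      fix r assume "r \<in> dist x ` B j"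
      then obtain z where z: "z \<in> B j" "r = dist x z" by auto
      have "r - diameter (B j) \<le> Inf (dist x ` B j)"
      proof (rule cInf_greatest[OF ne])
        fix r' assume "r' \<in> dist x ` B j"
        then obtain z' where z': "z' \<in> B j" "r' = dist x z'" by auto
        show "r - diameter (B j) \<le> r'"
          using z z' diameter_bounded_bound[OF assms(6)[OF j] z(1) z'(1)]
            dist_triangle[of x z z'] by (simp add: dist_commute)
      qed
      then show "r \<le> Inf (dist x ` B j) + diameter (B j)" by simp
    qed
    moreover have "0 \<le> diameter (B j)" using assms(6)[OF j] by (rule diameter_ge_0)
    ultimately show ?thesis by (simp add: F_def)
  qed
  have "connected (dist x ` A)"
    by (rule connected_continuous_image[OF _ assms(1)]) (intro continuous_intros)
  moreover have "0 \<in> dist x ` A" "dist x y \<in> dist x ` A"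
    using assms(2,3) by (auto intro: image_eqI[of _ _ x])
  ultimately have "{0..dist x y} \<subseteq> dist x ` A"
    by (rule connected_contains_Icc)
  also have "\<dots> \<subseteq> (\<Union>j\<in>I'. F j)"
    using assms(5) F1 unfolding I'_def by blast
  finally have "measure lborel {0..dist x y} \<le> measure lborel (\<Union>j\<in>I'. F j)"
    by (rule measure_mono_fmeasurable) (use I' in \<open>auto simp: F_def box_real[symmetric] simp del: box_real intro!: fmeasurable.finite_UN\<close>)
  also have "\<dots> \<le> (\<Sum>j\<in>I'. measure lborel (F j))"
    by (rule measure_UNION_le[OF I']) (simp add: F_def)
  also have "\<dots> \<le> (\<Sum>j\<in>I'. diameter (B j))"
    by (rule sum_mono) (rule F2)
  also have "\<dots> \<le> (\<Sum>j\<in>I. diameter (B j))"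
    by (rule sum_mono2) (use assms(4,6) in \<open>auto simp: I'_def intro: diameter_ge_0\<close>)
  finally show ?thesis by simp
qed


text \<open>\<open>p\<close> may visit the points of \<open>q\<close> in another order and
  repeatedly, so parameters cannot be compared directly. Instead, disjoint subarcs of
  \<open>q\<close> are covered by disjoint families of pieces of \<open>p\<close>; each chord of
  \<open>q\<close> is at most the sum of the diameters of its family, and all the diameters together
  are at most the length of \<open>p\<close>.\<close>

lemma arc_length_le:
  assumes p: "continuous_on {a..b} p" "rectifiable (a, b, p)"
    and q: "continuous_on {c..d} q" "inj_on q {c..d}" "q ` {c..d} \<subseteq> p ` {a..b}" "c \<le> d"
  shows "rectifiable (c, d, q)" "path_len (c, d, q) \<le> path_len (a, b, p)"
proof -
  have main: "(\<Sum>K\<in>D. chord q K) \<le> path_len (a, b, p)" if D: "D division_of {c..d}" for D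
  proof -
    \<comment> \<open>Each piece is cut at both ends by the fraction \<open>\<eta>\<close> of its
      length. Neighbouring subarcs then no longer share an endpoint and become disjoint compact
      sets; at the end \<open>\<eta>\<close> tends to 0.\<close>
    define l where "l \<eta> K = Inf K + \<eta> * (Sup K - Inf K)" for \<eta> and K :: "real set"
    define r where "r \<eta> K = Sup K - \<eta> * (Sup K - Inf K)" for \<eta> and K :: "real set"
    \<comment> \<open>Degenerate pieces have empty interior, so cutting cannot move them into it;
      their chords are zero anyway.\<close>
    define D' where "D' = {K\<in>D. Inf K < Sup K}"
    have finD: "finite D" and finD': "finite D'"
      using division_ofD(1)[OF D] by (auto simp: D'_def)
    have K_eq: "{Inf K..Sup K} = K" "Inf K \<le> Sup K" "K \<subseteq> {c..d}" if K: "K \<in> D" for K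
    proof -
      obtain u v where "K = {u..v}" "u \<le> v" using division_of_realE[OF D K] .
      then show "{Inf K..Sup K} = K" "Inf K \<le> Sup K" by simp_all
      show "K \<subseteq> {c..d}" using division_ofD(2)[OF D K] .
    qed
    have shrunk: "(\<Sum>K\<in>D'. norm (q (r \<eta> K) - q (l \<eta> K))) \<le> path_len (a, b, p)"
      if \<eta>: "0 < \<eta>" "\<eta> < 1/2" for \<eta>
    proof -
      define A where "A K = q ` {l \<eta> K..r \<eta> K}" for K
      have lr: "Inf K < l \<eta> K" "r \<eta> K < Sup K" "l \<eta> K \<le> r \<eta> K" if "K \<in> D'" for K
      proof -
        have "0 < Sup K - Inf K" using that by (simp add: D'_def)
        then have "0 < \<eta> * (Sup K - Inf K)" "\<eta> * (Sup K - Inf K) \<le> 1/2 * (Sup K - Inf K)"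
          using \<eta> by (simp_all add: mult_right_mono)
        then show "Inf K < l \<eta> K" "r \<eta> K < Sup K" "l \<eta> K \<le> r \<eta> K"
          by (simp_all add: l_def r_def)
      qed
      have lr_int: "{l \<eta> K..r \<eta> K} \<subseteq> interior K" if "K \<in> D'" for K
      proof -
        have "{l \<eta> K..r \<eta> K} \<subseteq> {Inf K<..<Sup K}"
          using lr(1,2)[OF that] by (intro subsetI) (meson atLeastAtMost_iff greaterThanLessThan_iff
              le_less_trans less_le_trans)
        also have "\<dots> = interior {Inf K..Sup K}" by (simp only: interior_atLeastAtMost_real)
        also have "\<dots> = interior K" by (simp only: K_eq(1) that[unfolded D'_def mem_Collect_eq])
        finally show ?thesis .
      qed
      have lr_sub: "{l \<eta> K..r \<eta> K} \<subseteq> {c..d}" if "K \<in> D'" for K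
        using lr_int[OF that] interior_subset[of K] K_eq(3)[of K] that unfolding D'_def by blast
      \<comment> \<open>Injectivity of \<open>q\<close> enters here: disjoint parameter intervals
        have disjoint images.\<close>
      have A_disj: "A K \<inter> A K' = {}" if "K \<in> D'" "K' \<in> D'" "K \<noteq> K'" for K K'
      proof -
        have "{l \<eta> K..r \<eta> K} \<inter> {l \<eta> K'..r \<eta> K'} = {}"
          using lr_int[OF that(1)] lr_int[OF that(2)] division_ofD(5)[OF D _ _ that(3)] that(1,2)
          unfolding D'_def by blast
        then show ?thesis
          using inj_on_image_Int[OF q(2) lr_sub[OF that(1)] lr_sub[OF that(2)]] by (simp add: A_def)
      qed
      have A_compact: "compact (A K)" and A_conn: "connected (A K)" if "K \<in> D'" for K
        unfolding A_def using lr_sub[OF that] q(1)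
        by (auto intro!: compact_continuous_image connected_continuous_image
            intro: continuous_on_subset)
      \<comment> \<open>The gauge forces a piece of \<open>p\<close> to meet no \<open>A K\<close> except one through its tag point.\<close>
      have "\<exists>U. x \<in> U \<and> open U \<and> (\<forall>s\<in>U \<inter> {a..b}. \<forall>K\<in>D'. p s \<in> A K \<longrightarrow> p x \<in> A K)" for x
      proof (cases "x \<in> {a..b}")
        case True
        \<comment> \<open>\<open>V\<close> is the complement of the finitely many compact subarcs
          that miss \<open>p x\<close>, hence an open set containing \<open>p x\<close>.\<close>
        define V where "V = - (\<Union>K\<in>{K\<in>D'. p x \<notin> A K}. A K)"
        have "open V"
          unfolding V_def by (rule open_Compl, rule compact_imp_closed, rule compact_UN)
            (use finD' A_compact in auto)
        then obtain U where U: "open U" "U \<inter> {a..b} = p -` V \<inter> {a..b}"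
          using p(1) by (metis continuous_on_open_invariant)
        moreover have "p x \<in> V" by (auto simp: V_def)
        ultimately have "x \<in> U" using True by auto
        moreover have "\<forall>s\<in>U \<inter> {a..b}. \<forall>K\<in>D'. p s \<in> A K \<longrightarrow> p x \<in> A K"
          unfolding U(2) by (auto simp: V_def)
        ultimately show ?thesis using U(1) by blast
      next
        case False
        then show ?thesis
          by (intro exI[of _ "- {a..b}"]) auto
      qed
      then obtain U where U: "\<And>x. x \<in> U x" "\<And>x. open (U x)"
          "\<And>x s K. s \<in> U x \<Longrightarrow> s \<in> {a..b} \<Longrightarrow> K \<in> D' \<Longrightarrow> p s \<in> A K \<Longrightarrow> p x \<in> A K"
        by (metis IntI)
      have "gauge U" using U(1,2) by (simp add: gauge_def)
      then obtain P where P: "P tagged_division_of {a..b}" "U fine P"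
        by (rule fine_division_exists_real)
      note PD = tagged_division_ofD[OF P(1)]
      have divP: "snd ` P division_of {a..b}"
        by (rule division_of_tagged_division[OF P(1)])
      have compact_piece: "compact (p ` J)" "p ` J \<noteq> {}" if J: "J \<in> snd ` P" for J
      proof -
        obtain u v where uv: "J = {u..v}" "u \<le> v" using division_of_realE[OF divP J] .
        moreover have "J \<subseteq> {a..b}" using division_ofD(2)[OF divP J] .
        ultimately show "compact (p ` J)" "p ` J \<noteq> {}"
          by (auto intro!: compact_continuous_image continuous_on_subset[OF p(1)])
      qed
      have piece: "norm (q (r \<eta> K) - q (l \<eta> K))
          \<le> (\<Sum>x\<in>{x\<in>P. p (fst x) \<in> A K}. diameter (p ` snd x))" if K: "K \<in> D'" for K
      proof -
        have "dist (q (r \<eta> K)) (q (l \<eta> K))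
            \<le> (\<Sum>x\<in>{x\<in>P. p (fst x) \<in> A K}. diameter (p ` snd x))"
        proof (rule dist_le_sum_diameter[OF A_conn[OF K]])
          show "q (r \<eta> K) \<in> A K" "q (l \<eta> K) \<in> A K"
            using lr[OF K] by (auto simp: A_def)
          show "finite {x \<in> P. p (fst x) \<in> A K}" using PD(1) by simp
          show "A K \<subseteq> (\<Union>x\<in>{x\<in>P. p (fst x) \<in> A K}. p ` snd x)"
          proof
            fix z assume z: "z \<in> A K"
            then have "z \<in> p ` {a..b}"
              using q(3) lr_sub[OF K] by (auto simp: A_def)
            then obtain s where s: "s \<in> {a..b}" "z = p s" by blast
            then obtain t J where J: "(t, J) \<in> P" "s \<in> J" using PD(6) by blast
            then have "s \<in> U t" using P(2) by blast
            then have "p t \<in> A K" using U(3) s z K by blast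
            then show "z \<in> (\<Union>x\<in>{x\<in>P. p (fst x) \<in> A K}. p ` snd x)"
              using J s(2) by force
          qed
        next
          fix x assume "x \<in> {x\<in>P. p (fst x) \<in> A K}"
          then show "bounded (p ` snd x)" by (intro compact_imp_bounded compact_piece(1) imageI) simp
        qed
        then show ?thesis by (simp add: dist_norm)
      qed
      have dnn: "0 \<le> diameter (p ` snd x)" if "x \<in> P" for x
        by (intro diameter_ge_0 compact_imp_bounded compact_piece(1) imageI that)
      have "(\<Sum>K\<in>D'. norm (q (r \<eta> K) - q (l \<eta> K)))
          \<le> (\<Sum>K\<in>D'. \<Sum>x\<in>{x\<in>P. p (fst x) \<in> A K}. diameter (p ` snd x))"
        by (rule sum_mono) (rule piece)
      \<comment> \<open>The image of a tag lies on at most one subarc, so no piece of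
        \<open>p\<close> is charged to two different \<open>K\<close>.\<close>
      also have "\<dots> = (\<Sum>x\<in>(\<Union>K\<in>D'. {x\<in>P. p (fst x) \<in> A K}). diameter (p ` snd x))"
      proof (rule sum.UNION_disjoint[symmetric])
        show "\<forall>K\<in>D'. finite {x\<in>P. p (fst x) \<in> A K}" using PD(1) by simp
        show "\<forall>K\<in>D'. \<forall>K'\<in>D'. K \<noteq> K' \<longrightarrow>
            {x\<in>P. p (fst x) \<in> A K} \<inter> {x\<in>P. p (fst x) \<in> A K'} = {}"
          using A_disj by blast
      qed (rule finD')
      also have "\<dots> \<le> (\<Sum>x\<in>P. diameter (p ` snd x))"
        by (rule sum_mono2[OF PD(1)]) (blast, use dnn in blast)
      also have "\<dots> = (\<Sum>(t, J)\<in>P. diameter (p ` J))"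
        by (simp add: case_prod_unfold)
      \<comment> \<open>The same interval can carry two tags only if it has empty interior; then its
        image has diameter 0.\<close>
      also have "\<dots> = (\<Sum>J\<in>snd ` P. diameter (p ` J))"
      proof (rule sum.over_tagged_division_lemma[OF P(1)])
        fix u v :: real assume "box u v = {}"
        then have "v \<le> u" by (simp add: box_real not_less)
        then have "cbox u v = {} \<or> cbox u v = {u}" by (auto simp: box_real)
        then show "diameter (p ` cbox u v) = 0" by auto
      qed
      also have "\<dots> \<le> path_len (a, b, p)"
      proof -
        have "\<forall>J\<in>snd ` P. \<exists>s t. s \<in> J \<and> t \<in> J \<and> norm (p t - p s) = diameter (p ` J)"
        proof
          fix J assume "J \<in> snd ` P"
          from diameter_compact_attained[OF compact_piece[OF this]]
          show "\<exists>s t. s \<in> J \<and> t \<in> J \<and> norm (p t - p s) = diameter (p ` J)"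
            unfolding dist_norm by blast
        qed
        then obtain s t where st: "\<And>J. J \<in> snd ` P \<Longrightarrow> s J \<in> J" "\<And>J. J \<in> snd ` P \<Longrightarrow> t J \<in> J"
            "\<And>J. J \<in> snd ` P \<Longrightarrow> norm (p (t J) - p (s J)) = diameter (p ` J)"
          by metis
        have "(\<Sum>J\<in>snd ` P. norm (p (t J) - p (s J))) \<le> path_len (a, b, p)"
          by (rule path_len_ge_chords[OF p(2) divP]) (use st in auto)
        then show ?thesis using st(3) by simp
      qed
      finally show ?thesis .
    qed
    \<comment> \<open>By continuity of \<open>q\<close>, the chords of the shortened pieces converge
      to those of the full pieces, which carries the bound \<open>shrunk\<close> over to
      \<open>D'\<close>.\<close>
    have lim: "((\<lambda>\<eta>. \<Sum>K\<in>D'. norm (q (r \<eta> K) - q (l \<eta> K))) \<longlongrightarrow> (\<Sum>K\<in>D'. chord q K)) (at_right 0)"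
    proof (intro tendsto_sum tendsto_norm tendsto_diff)
      fix K assume K: "K \<in> D'"
      have lt: "0 < Sup K - Inf K" using K by (simp add: D'_def)
      have sub: "{Inf K..Sup K} \<subseteq> {c..d}"
        using K K_eq(1,3)[of K] unfolding D'_def by blast
      have in_K: "l \<eta> K \<in> {c..d}" "r \<eta> K \<in> {c..d}" if \<eta>: "0 < \<eta>" "\<eta> < 1/2" for \<eta>
      proof -
        define e where "e = \<eta> * (Sup K - Inf K)"
        have "0 < e" using \<eta> lt by (simp add: e_def)
        moreover have "e \<le> 1/2 * (Sup K - Inf K)"
          unfolding e_def by (rule mult_right_mono) (use \<eta> lt in auto)
        moreover have "l \<eta> K = Inf K + e" "r \<eta> K = Sup K - e"
          by (simp_all add: l_def r_def e_def)
        ultimately have "l \<eta> K \<in> {Inf K..Sup K}" "r \<eta> K \<in> {Inf K..Sup K}"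
          using lt by auto
        then show "l \<eta> K \<in> {c..d}" "r \<eta> K \<in> {c..d}" using sub by blast+
      qed
      have ev: "\<forall>\<^sub>F \<eta> in at_right (0::real). 0 < \<eta> \<and> \<eta> < 1/2"
        unfolding eventually_at_right_field by (auto intro!: exI[of _ "1/2"])
      have tl: "((\<lambda>\<eta>. l \<eta> K) \<longlongrightarrow> Inf K) (at_right 0)" and tr: "((\<lambda>\<eta>. r \<eta> K) \<longlongrightarrow> Sup K) (at_right 0)"
        unfolding l_def r_def by (auto intro!: tendsto_eq_intros)
      have mem: "Inf K \<in> {c..d}" "Sup K \<in> {c..d}" using sub lt by auto
      show "((\<lambda>\<eta>. q (r \<eta> K)) \<longlongrightarrow> q (Sup K)) (at_right 0)"
        by (rule continuous_on_tendsto_compose[OF q(1) tr mem(2)])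
          (rule eventually_mono[OF ev], use in_K in blast)
      show "((\<lambda>\<eta>. q (l \<eta> K)) \<longlongrightarrow> q (Inf K)) (at_right 0)"
        by (rule continuous_on_tendsto_compose[OF q(1) tl mem(1)])
          (rule eventually_mono[OF ev], use in_K in blast)
    qed
    have "(\<Sum>K\<in>D. chord q K) = (\<Sum>K\<in>D'. chord q K)"
    proof (rule sum.mono_neutral_right[OF finD])
      show "D' \<subseteq> D" by (auto simp: D'_def)
      have "Sup K = Inf K" if "K \<in> D - D'" for K
        using K_eq(2)[of K] that by (auto simp: D'_def)
      then show "\<forall>K\<in>D - D'. chord q K = 0" by simp
    qed
    also have "\<dots> \<le> path_len (a, b, p)"
    proof (rule tendsto_upperbound[OF lim])
      show "\<forall>\<^sub>F \<eta> in at_right 0. (\<Sum>K\<in>D'. norm (q (r \<eta> K) - q (l \<eta> K))) \<le> path_len (a, b, p)"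
        unfolding eventually_at_right_field using shrunk by (auto intro!: exI[of _ "1/2"])
    qed simp
    finally show ?thesis .
  qed
  show "rectifiable (c, d, q)" "path_len (c, d, q) \<le> path_len (a, b, p)"
    using path_len_le[OF q(4) main] by blast+
qed

text \<open>A Hausdorff path with distinct endpoints contains an arc between them. That is purely
  topological; the length bound comes from \<open>arc_length_le\<close>, which needs only the
  inclusion of the images.\<close>

lemma rectifiable_arc_exists:
  assumes "path_in Y p" "rectifiable p" "start_pt p \<noteq> end_pt p"
  obtains q where "path_in Y q" "rectifiable q" "injective_path q"
    "start_pt q = start_pt p" "end_pt q = end_pt p" "path_len q \<le> path_len p"
proof -
  obtain a b \<gamma> where p: "p = (a, b, \<gamma>)" using prod_cases3 .
  have \<gamma>: "a < b" "continuous_on {a..b} \<gamma>" "\<gamma> ` {a..b} \<subseteq> Y"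
    using assms(1) by (auto simp: p path_in_def)
  \<comment> \<open>Affine change of parameter to the unit interval, on which
    \<open>path_contains_arc\<close> operates.\<close>
  define \<gamma>' where "\<gamma>' = \<gamma> \<circ> (\<lambda>x. (b - a) * x + a)"
  have im: "(\<lambda>x. (b - a) * x + a) ` {0..1} = {a..b}"
    using \<gamma>(1) by (subst image_affinity_atLeastAtMost) auto
  have "path \<gamma>'"
    unfolding path_def \<gamma>'_def
    by (rule continuous_on_compose) (auto intro!: continuous_intros simp: im \<gamma>(2))
  moreover have "pathstart \<gamma>' = \<gamma> a" "pathfinish \<gamma>' = \<gamma> b"
    by (simp_all add: \<gamma>'_def pathstart_def pathfinish_def)
  moreover have "\<gamma> a \<noteq> \<gamma> b" using assms(3) by (simp add: p start_pt_def end_pt_def)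
  ultimately obtain q where q: "arc q" "path_image q \<subseteq> path_image \<gamma>'" "pathstart q = \<gamma> a" "pathfinish q = \<gamma> b"
    by (rule path_contains_arc)
  \<comment> \<open>\<open>path_in\<close> demands the value \<open>undefined\<close> outside the
    parameter interval.\<close>
  define q' where "q' = restrict q {0..1}"
  have "path_image \<gamma>' = \<gamma> ` {a..b}"
    by (simp only: path_image_def \<gamma>'_def image_comp[symmetric] im)
  then have q'_im: "q' ` {0..1} \<subseteq> \<gamma> ` {a..b}"
    using q(2) by (auto simp: q'_def path_image_def)
  have q'_cont: "continuous_on {0..1} q'" and q'_inj: "inj_on q' {0..1}"
    using q(1) continuous_on_cong[of "{0..1}" "{0..1}" q' q] inj_on_cong[of "{0..1}" q' q]
    by (simp_all add: q'_def arc_def path_def)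
  show thesis
  proof (rule that[of "(0, 1, q')"])
    show "path_in Y (0, 1, q')"
      using q'_im q'_cont \<gamma>(3) by (auto simp: path_in_def q'_def)
    show "injective_path (0, 1, q')" using q'_inj by (simp add: injective_path_def)
    show "rectifiable (0, 1, q')" "path_len (0, 1, q') \<le> path_len p"
      using arc_length_le[OF \<gamma>(2) _ q'_cont q'_inj q'_im] assms(2) by (auto simp: p)
    show "start_pt (0, 1, q') = start_pt p" "end_pt (0, 1, q') = end_pt p"
      using q(3,4) by (auto simp: p start_pt_def end_pt_def q'_def pathstart_def pathfinish_def)
  qed
qed


section \<open>Riemann-Stieltjes sums and integrals along rectifiable paths\<close>

lemma tagged_division_of_realE:
  fixes K :: "real set"
  assumes "P tagged_division_of {a..b}" "(t, K) \<in> P"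
  obtains u v where "K = {u..v}" "u \<le> t" "t \<le> v" "a \<le> u" "v \<le> b"
proof -
  have "t \<in> K" "K \<subseteq> {a..b}" "\<exists>u v. K = cbox u v"
    using tagged_division_ofD[OF assms(1)] assms(2) by auto
  then show thesis using that by (force simp: box_real)
qed

text \<open>Cousin's lemma for balls of radius \<open>\<delta> / 2\<close>. It guarantees that the
  mesh condition in \<open>has_path_integral\<close> is satisfiable, so that bounds on sums pass to
  the integral.\<close>

lemma tagged_division_with_small_mesh:
  fixes a b \<delta> :: real
  assumes "\<delta> > 0"
  obtains P where "P tagged_division_of {a..b}" "\<forall>(t, K)\<in>P. Sup K - Inf K < \<delta>"
proof -
  have "gauge (\<lambda>x::real. ball x (\<delta> / 2))" using assms by (simp add: gauge_def)
  then obtain P where P: "P tagged_division_of {a..b}" "(\<lambda>x. ball x (\<delta> / 2)) fine P"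
    by (rule fine_division_exists_real)
  have "Sup K - Inf K < \<delta>" if tK: "(t, K) \<in> P" for t K
  proof -
    obtain u v where uv: "K = {u..v}" "u \<le> t" "t \<le> v"
      using tagged_division_of_realE[OF P(1) tK] by metis
    have "K \<subseteq> ball t (\<delta> / 2)" using P(2) tK by blast
    moreover have "u \<in> K" "v \<in> K" using uv by simp_all
    ultimately have "u \<in> ball t (\<delta> / 2)" "v \<in> ball t (\<delta> / 2)" by blast+
    then show ?thesis using uv by (simp add: dist_real_def)
  qed
  then show thesis using that P(1) by blast
qed

text \<open>The basic length estimate at the level of sums. It is applied to the deviation of an
  integrand from a constant and to the difference of two integrands.\<close>

lemma norm_stieltjes_sum_le:
  assumes "rectifiable (a, b, \<gamma>)" "P tagged_division_of {a..b}" "0 \<le> M"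
    and "\<And>t. t \<in> {a..b} \<Longrightarrow> norm (h t) \<le> M"
  shows "norm (\<Sum>(t, K)\<in>P. h t * (\<gamma> (Sup K) - \<gamma> (Inf K))) \<le> M * path_len (a, b, \<gamma>)"
proof -
  have "norm (\<Sum>(t, K)\<in>P. h t * (\<gamma> (Sup K) - \<gamma> (Inf K))) \<le> (\<Sum>(t, K)\<in>P. M * chord \<gamma> K)"
  proof (rule sum_norm_le)
    fix x assume x: "x \<in> P"
    obtain t K where tK: "x = (t, K)" by (cases x)
    have "t \<in> {a..b}" using tagged_division_ofD(2,3)[OF assms(2)] x tK by blast
    then show "norm (case x of (t, K) \<Rightarrow> h t * (\<gamma> (Sup K) - \<gamma> (Inf K))) \<le> (case x of (t, K) \<Rightarrow> M * chord \<gamma> K)"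
      using assms(4) by (simp add: tK norm_mult mult_right_mono)
  qed
  \<comment> \<open>\<open>Sup {}\<close> and \<open>Inf {}\<close> are unspecified reals, so \<open>chord \<gamma> {}\<close> need not vanish.\<close>
  also have "\<dots> = (\<Sum>(t, K)\<in>P. if K = {} then 0 else M * chord \<gamma> K)"
    by (intro sum.cong refl) (auto dest: tagged_division_ofD(2)[OF assms(2)])
  also have "\<dots> = (\<Sum>K\<in>snd ` P. if K = {} then 0 else M * chord \<gamma> K)"
  proof (rule sum.over_tagged_division_lemma[OF assms(2)])
    fix u v :: real assume "box u v = {}"
    then have "cbox u v = {} \<or> cbox u v = {u}" by auto
    then show "(if cbox u v = {} then 0 else M * chord \<gamma> (cbox u v)) = 0"
      by (elim disjE) (simp_all del: box_real)
  qed
  also have "\<dots> = (\<Sum>K\<in>snd ` P. M * chord \<gamma> K)"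
    using division_ofD(3)[OF division_of_tagged_division[OF assms(2)]] by (intro sum.cong) auto
  also have "\<dots> = M * (\<Sum>K\<in>snd ` P. chord \<gamma> K)"
    by (simp add: sum_distrib_left)
  also have "\<dots> \<le> M * path_len (a, b, \<gamma>)"
    by (rule mult_left_mono[OF path_len_ge_division[OF assms(1) division_of_tagged_division[OF assms(2)]] assms(3)])
  finally show ?thesis .
qed

text \<open>For the constant integrand \<open>w\<close> every sum telescopes to
  \<open>w * (\<gamma> b - \<gamma> a)\<close>, so only the deviation \<open>g - w\<close> has to be
  estimated.\<close>

lemma has_path_integral_bound:
  assumes "has_path_integral g I (a, b, \<gamma>)" "rectifiable (a, b, \<gamma>)" "a \<le> b" "0 \<le> M"
    and "\<And>t. t \<in> {a..b} \<Longrightarrow> norm (g (\<gamma> t) - w) \<le> M"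
  shows "norm (I - w * (\<gamma> b - \<gamma> a)) \<le> M * path_len (a, b, \<gamma>)"
proof (rule field_le_epsilon)
  fix \<epsilon> :: real assume "\<epsilon> > 0"
  then obtain \<delta> where \<delta>: "\<delta> > 0" "\<And>P. P tagged_division_of {a..b} \<Longrightarrow> (\<forall>(t, K)\<in>P. Sup K - Inf K < \<delta>) \<Longrightarrow>
      norm ((\<Sum>(t, K)\<in>P. g (\<gamma> t) * (\<gamma> (Sup K) - \<gamma> (Inf K))) - I) < \<epsilon>"
    using assms(1) unfolding has_path_integral_def by auto
  obtain P where P: "P tagged_division_of {a..b}" "\<forall>(t, K)\<in>P. Sup K - Inf K < \<delta>"
    using tagged_division_with_small_mesh[OF \<delta>(1)] .
  define S where "S = (\<Sum>(t, K)\<in>P. g (\<gamma> t) * (\<gamma> (Sup K) - \<gamma> (Inf K)))"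
  have "w * (\<gamma> b - \<gamma> a) = (\<Sum>(t, K)\<in>P. w * (\<gamma> (Sup K) - \<gamma> (Inf K)))"
    by (simp add: additive_tagged_division_1[OF assms(3) P(1), symmetric] sum_distrib_left case_prod_unfold)
  then have "S - w * (\<gamma> b - \<gamma> a) = (\<Sum>(t, K)\<in>P. (g (\<gamma> t) - w) * (\<gamma> (Sup K) - \<gamma> (Inf K)))"
    by (simp add: S_def sum_subtractf[symmetric] case_prod_unfold left_diff_distrib)
  also have "norm \<dots> \<le> M * path_len (a, b, \<gamma>)"
    by (rule norm_stieltjes_sum_le[OF assms(2) P(1) assms(4,5)])
  finally have "norm (S - w * (\<gamma> b - \<gamma> a)) \<le> M * path_len (a, b, \<gamma>)" .
  moreover have "norm (S - I) < \<epsilon>" using \<delta>(2)[OF P] by (simp add: S_def)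
  moreover have "norm (I - w * (\<gamma> b - \<gamma> a)) \<le> norm (S - w * (\<gamma> b - \<gamma> a)) + norm (S - I)"
    using norm_triangle_ineq4[of "S - w * (\<gamma> b - \<gamma> a)" "S - I"] by simp
  ultimately show "norm (I - w * (\<gamma> b - \<gamma> a)) \<le> M * path_len (a, b, \<gamma>) + \<epsilon>" by linarith
qed

text \<open>An argument with three errors: replacing \<open>h\<close> by one \<open>g n\<close>, the
  sum for \<open>g n\<close> against \<open>I n\<close>, and \<open>I n\<close> against
  \<open>J\<close>. The mesh is the one belonging to that single \<open>n\<close>.\<close>

lemma has_path_integral_uniform_limit:
  assumes "\<And>n. has_path_integral (g n) (I n) (a, b, \<gamma>)" "rectifiable (a, b, \<gamma>)" "a \<le> b"
    and "uniform_limit (\<gamma> ` {a..b}) g h sequentially" "I \<longlonglongrightarrow> J"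
  shows "has_path_integral h J (a, b, \<gamma>)"
  unfolding has_path_integral_def split_conv
proof (intro allI impI)
  fix \<epsilon> :: real assume \<epsilon>: "\<epsilon> > 0"
  define C where "C = path_len (a, b, \<gamma>)"
  have C: "0 \<le> C" using path_len_nonneg assms(2,3) by (simp add: C_def)
  \<comment> \<open>Chosen so that \<open>\<eta> * C \<le> \<epsilon> / 3\<close>; adding 1 keeps
    the denominator positive when \<open>C = 0\<close>.\<close>
  define \<eta> where "\<eta> = \<epsilon> / (3 * (C + 1))"
  have \<eta>: "\<eta> > 0" using \<epsilon> C by (simp add: \<eta>_def)
  have \<eta>C: "\<eta> * C \<le> \<epsilon> / 3"
    using \<epsilon> C by (simp add: \<eta>_def divide_simps)
  have "\<forall>\<^sub>F n in sequentially. (\<forall>x\<in>\<gamma> ` {a..b}. dist (g n x) (h x) < \<eta>) \<and> dist (I n) J < \<epsilon> / 3"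
    using \<epsilon> by (intro eventually_conj uniform_limitD[OF assms(4) \<eta>] tendstoD[OF assms(5)]) simp
  then obtain n where n: "\<And>x. x \<in> \<gamma> ` {a..b} \<Longrightarrow> dist (g n x) (h x) < \<eta>" "dist (I n) J < \<epsilon> / 3"
    using eventually_happens'[OF sequentially_bot] by blast
  obtain \<delta> where \<delta>: "\<delta> > 0" "\<And>P. P tagged_division_of {a..b} \<Longrightarrow> (\<forall>(t, K)\<in>P. Sup K - Inf K < \<delta>) \<Longrightarrow>
      norm ((\<Sum>(t, K)\<in>P. g n (\<gamma> t) * (\<gamma> (Sup K) - \<gamma> (Inf K))) - I n) < \<epsilon> / 3"
    using assms(1)[of n, unfolded has_path_integral_def split_conv, rule_format, of "\<epsilon> / 3"] \<epsilon>
    by auto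
  show "\<exists>\<delta>>0. \<forall>P. P tagged_division_of {a..b} \<and> (\<forall>(t, K)\<in>P. Sup K - Inf K < \<delta>) \<longrightarrow>
      norm ((\<Sum>(t, K)\<in>P. h (\<gamma> t) * (\<gamma> (Sup K) - \<gamma> (Inf K))) - J) < \<epsilon>"
  proof (intro exI[of _ \<delta>] conjI allI impI \<delta>(1), elim conjE)
    fix P assume P: "P tagged_division_of {a..b}" "\<forall>(t, K)\<in>P. Sup K - Inf K < \<delta>"
    define S where "S k = (\<Sum>(t, K)\<in>P. k (\<gamma> t) * (\<gamma> (Sup K) - \<gamma> (Inf K)))" for k
    have "S h - S (g n) = (\<Sum>(t, K)\<in>P. (h (\<gamma> t) - g n (\<gamma> t)) * (\<gamma> (Sup K) - \<gamma> (Inf K)))"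
      by (simp add: S_def sum_subtractf[symmetric] case_prod_unfold left_diff_distrib)
    also have "norm \<dots> \<le> \<eta> * path_len (a, b, \<gamma>)"
      using n(1) \<eta> by (intro norm_stieltjes_sum_le[OF assms(2) P(1)])
        (force simp: dist_norm norm_minus_commute intro: less_imp_le)+
    finally have "norm (S h - S (g n)) \<le> \<epsilon> / 3" using \<eta>C by (simp add: C_def)
    moreover have "norm (S (g n) - I n) < \<epsilon> / 3" using \<delta>(2)[OF P] by (simp add: S_def)
    moreover have "norm (S h - J) \<le> norm (S h - S (g n)) + norm (S (g n) - I n) + norm (I n - J)"
      using norm_triangle_ineq[of "S h - S (g n)" "S (g n) - J"]
        norm_triangle_ineq[of "S (g n) - I n" "I n - J"] by simp
    ultimately have "norm (S h - J) < \<epsilon>" using n(2) by (simp add: dist_norm)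
    then show "norm ((\<Sum>(t, K)\<in>P. h (\<gamma> t) * (\<gamma> (Sup K) - \<gamma> (Inf K))) - J) < \<epsilon>"
      by (simp add: S_def)
  qed
qed

section \<open>The fundamental theorem of calculus along rectifiable paths\<close>

text \<open>A mean value inequality with the increments of \<open>V\<close> in place of a derivative
  bound. Each piece of a fine tagged division is split at its tag, monotonicity removes the absolute
  values on both sides, and the sums telescope.\<close>

lemma norm_increment_le:
  fixes \<phi> :: "real \<Rightarrow> 'a::real_normed_vector" and V :: "real \<Rightarrow> real"
  assumes "c \<le> d" "mono_on {c..d} V"
    and loc: "\<And>t. t \<in> {c..d} \<Longrightarrow>
      \<exists>\<delta>>0. \<forall>s\<in>{c..d}. \<bar>s - t\<bar> < \<delta> \<longrightarrow> norm (\<phi> s - \<phi> t) \<le> \<bar>V s - V t\<bar>"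
  shows "norm (\<phi> d - \<phi> c) \<le> V d - V c"
proof -
  have "\<exists>\<delta>>0. t \<in> {c..d} \<longrightarrow> (\<forall>s\<in>{c..d}. \<bar>s - t\<bar> < \<delta> \<longrightarrow> norm (\<phi> s - \<phi> t) \<le> \<bar>V s - V t\<bar>)" for t
    by (cases "t \<in> {c..d}") (use loc in \<open>auto intro: exI[of _ 1]\<close>)
  then obtain \<delta> where \<delta>: "\<And>t. \<delta> t > 0"
    "\<And>t s. t \<in> {c..d} \<Longrightarrow> s \<in> {c..d} \<Longrightarrow> \<bar>s - t\<bar> < \<delta> t \<Longrightarrow> norm (\<phi> s - \<phi> t) \<le> \<bar>V s - V t\<bar>"
    by metis
  have "gauge (\<lambda>t. ball t (\<delta> t))" using \<delta>(1) by (simp add: gauge_def)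
  then obtain P where P: "P tagged_division_of {c..d}" "(\<lambda>t. ball t (\<delta> t)) fine P"
    by (rule fine_division_exists_real)
  have "norm (\<phi> d - \<phi> c) = norm (\<Sum>(t, K)\<in>P. \<phi> (Sup K) - \<phi> (Inf K))"
    by (simp only: additive_tagged_division_1[OF assms(1) P(1)])
  also have "\<dots> \<le> (\<Sum>(t, K)\<in>P. V (Sup K) - V (Inf K))"
  proof (rule sum_norm_le)
    fix x assume x: "x \<in> P"
    obtain t K where tK: "x = (t, K)" by (cases x)
    obtain u v where uv: "K = {u..v}" "u \<le> t" "t \<le> v" "c \<le> u" "v \<le> d"
      using tagged_division_of_realE[OF P(1)] x tK by metis
    have "K \<subseteq> ball t (\<delta> t)" using P(2) x tK by blast
    moreover have "u \<in> K" "v \<in> K" using uv by simp_all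
    ultimately have "u \<in> ball t (\<delta> t)" "v \<in> ball t (\<delta> t)" by blast+
    then have close: "\<bar>u - t\<bar> < \<delta> t" "\<bar>v - t\<bar> < \<delta> t"
      by (simp_all add: dist_real_def abs_minus_commute)
    have mem: "t \<in> {c..d}" "u \<in> {c..d}" "v \<in> {c..d}" using uv by auto
    have "V u \<le> V t" "V t \<le> V v"
      using mono_onD[OF assms(2)] mem uv by blast+
    then have "norm (\<phi> u - \<phi> t) \<le> V t - V u" "norm (\<phi> v - \<phi> t) \<le> V v - V t"
      using \<delta>(2)[OF mem(1) mem(2) close(1)] \<delta>(2)[OF mem(1) mem(3) close(2)] by auto
    then have "norm (\<phi> v - \<phi> u) \<le> V v - V u"
      using norm_triangle_ineq4[of "\<phi> v - \<phi> t" "\<phi> u - \<phi> t"] by simp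
    then show "norm (case x of (t, K) \<Rightarrow> \<phi> (Sup K) - \<phi> (Inf K)) \<le> (case x of (t, K) \<Rightarrow> V (Sup K) - V (Inf K))"
      using uv by (simp add: tK)
  qed
  also have "\<dots> = V d - V c"
    by (rule additive_tagged_division_1[OF assms(1) P(1)])
  finally show ?thesis .
qed

text \<open>On a short piece with tag \<open>t\<close>, replacing \<open>f\<close> by the linear
  function with slope \<open>g (\<gamma> t)\<close> costs at most \<open>2 * \<eta>\<close> times
  the variation of \<open>\<gamma>\<close> there. Summing over the pieces gives at most
  \<open>2 * \<eta> * C\<close>.\<close>

lemma path_integral_of_derivative:
  assumes "rectifiable (a, b, \<gamma>)" "a \<le> b" "continuous_on {a..b} \<gamma>" "\<gamma> ` {a..b} \<subseteq> X"
    and "continuous_on X g" "\<And>z. z \<in> X \<Longrightarrow> (f has_field_derivative g z) (at z within X)"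
  shows "has_path_integral g (f (\<gamma> b) - f (\<gamma> a)) (a, b, \<gamma>)"
  unfolding has_path_integral_def split_conv
proof (intro allI impI)
  fix \<epsilon> :: real assume \<epsilon>: "\<epsilon> > 0"
  define V where "V t = path_len (a, t, \<gamma>)" for t
  define C where "C = V b - V a"
  have V: "norm (\<gamma> d - \<gamma> c) \<le> V d - V c" if "a \<le> c" "c \<le> d" "d \<le> b" for c d
    unfolding V_def by (rule path_len_initial_increment[OF assms(1) that])
  have V_abs: "norm (\<gamma> d - \<gamma> c) \<le> \<bar>V d - V c\<bar>" if "c \<in> {a..b}" "d \<in> {a..b}" for c d
    using V[of c d] V[of d c] that by (cases "c \<le> d") (auto simp: norm_minus_commute)
  have C: "0 \<le> C" using V[of a b] norm_ge_zero[of "\<gamma> b - \<gamma> a"] assms(2) unfolding C_def by linarith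
  \<comment> \<open>Makes \<open>2 * \<eta> * C < \<epsilon>\<close>, again with 1 added in case
    \<open>C = 0\<close>.\<close>
  define \<eta> where "\<eta> = \<epsilon> / (2 * (C + 1))"
  have \<eta>: "\<eta> > 0" using \<epsilon> C by (simp add: \<eta>_def)
  have \<eta>C: "2 * \<eta> * C < \<epsilon>"
    using \<epsilon> C by (simp add: \<eta>_def divide_simps)
  have "continuous_on {a..b} (\<lambda>t. g (\<gamma> t))"
    by (rule continuous_on_compose2[OF assms(5,3,4)])
  then have "uniformly_continuous_on {a..b} (\<lambda>t. g (\<gamma> t))"
    by (rule compact_uniformly_continuous) simp
  then obtain \<delta> where \<delta>: "\<delta> > 0"
      "\<And>s t. s \<in> {a..b} \<Longrightarrow> t \<in> {a..b} \<Longrightarrow> dist s t < \<delta> \<Longrightarrow> dist (g (\<gamma> s)) (g (\<gamma> t)) < \<eta>"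
    using \<eta> unfolding uniformly_continuous_on_def by metis
  \<comment> \<open>The integral requires one mesh for all pieces. This \<open>\<delta>\<close>
    comes from uniform continuity of \<open>g\<close> along \<open>\<gamma>\<close> alone; the radii
    from differentiability of \<open>f\<close> vary with the point and are absorbed inside the piece
    by \<open>norm_increment_le\<close>.\<close>
  have piece: "norm (g (\<gamma> t) * (\<gamma> v - \<gamma> u) - (f (\<gamma> v) - f (\<gamma> u))) \<le> 2 * \<eta> * V v - 2 * \<eta> * V u"
    if uv: "a \<le> u" "u \<le> t" "t \<le> v" "v \<le> b" "v - u < \<delta>" for t u v
  proof -
    define \<phi> where "\<phi> s = g (\<gamma> t) * \<gamma> s - f (\<gamma> s)" for s
    have "norm (\<phi> v - \<phi> u) \<le> 2 * \<eta> * V v - 2 * \<eta> * V u"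
    proof (rule norm_increment_le)
      show "mono_on {u..v} (\<lambda>s. 2 * \<eta> * V s)"
      proof (rule mono_onI)
        fix r s assume "r \<in> {u..v}" "s \<in> {u..v}" "r \<le> s"
        then have "norm (\<gamma> s - \<gamma> r) \<le> V s - V r" using V[of r s] uv by simp
        then have "V r \<le> V s" using norm_ge_zero[of "\<gamma> s - \<gamma> r"] by linarith
        then show "2 * \<eta> * V r \<le> 2 * \<eta> * V s" using \<eta> by simp
      qed
    next
      fix x assume x: "x \<in> {u..v}"
      have xab: "x \<in> {a..b}" and tab: "t \<in> {a..b}" using x uv by auto
      have "\<gamma> x \<in> X" using assms(4) xab by auto
      from assms(6)[OF this] \<eta> obtain e where e: "e > 0"
        "\<And>y. y \<in> X \<Longrightarrow> norm (y - \<gamma> x) < e \<Longrightarrow>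
          norm (f y - f (\<gamma> x) - g (\<gamma> x) * (y - \<gamma> x)) \<le> \<eta> * norm (y - \<gamma> x)"
        unfolding has_field_derivative_def has_derivative_within_alt by blast
      from assms(3) xab e(1) obtain d where d: "d > 0"
        "\<And>s. s \<in> {a..b} \<Longrightarrow> dist s x < d \<Longrightarrow> dist (\<gamma> s) (\<gamma> x) < e"
        unfolding continuous_on_iff by metis
      have "dist x t < \<delta>" using x uv by (auto simp: dist_real_def abs_less_iff)
      then have gx: "norm (g (\<gamma> x) - g (\<gamma> t)) \<le> \<eta>"
        using \<delta>(2)[OF xab tab] by (simp add: dist_norm)
      have "norm (\<phi> s - \<phi> x) \<le> \<bar>2 * \<eta> * V s - 2 * \<eta> * V x\<bar>"
        if s: "s \<in> {u..v}" "\<bar>s - x\<bar> < d" for s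
      proof -
        have sab: "s \<in> {a..b}" using s uv by auto
        have "norm (f (\<gamma> s) - f (\<gamma> x) - g (\<gamma> x) * (\<gamma> s - \<gamma> x)) \<le> \<eta> * norm (\<gamma> s - \<gamma> x)"
        proof (rule e(2))
          show "\<gamma> s \<in> X" using assms(4) sab by blast
          show "norm (\<gamma> s - \<gamma> x) < e" using d(2)[OF sab] s(2) by (simp add: dist_norm)
        qed
        moreover have "norm ((g (\<gamma> x) - g (\<gamma> t)) * (\<gamma> s - \<gamma> x)) \<le> \<eta> * norm (\<gamma> s - \<gamma> x)"
          unfolding norm_mult by (rule mult_right_mono[OF gx norm_ge_zero])
        \<comment> \<open>Two errors, each at most
          \<open>\<eta> * norm (\<gamma> s - \<gamma> x)\<close>: the linearization of
          \<open>f\<close> at \<open>\<gamma> x\<close>, and the change of slope from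
          \<open>\<gamma> t\<close> to \<open>\<gamma> x\<close>. Hence the factor 2.\<close>
        moreover have "\<phi> s - \<phi> x = - (f (\<gamma> s) - f (\<gamma> x) - g (\<gamma> x) * (\<gamma> s - \<gamma> x))
            - (g (\<gamma> x) - g (\<gamma> t)) * (\<gamma> s - \<gamma> x)"
          by (simp add: \<phi>_def algebra_simps)
        ultimately have "norm (\<phi> s - \<phi> x) \<le> 2 * \<eta> * norm (\<gamma> s - \<gamma> x)"
          using norm_triangle_ineq4[of "- (f (\<gamma> s) - f (\<gamma> x) - g (\<gamma> x) * (\<gamma> s - \<gamma> x))"
              "(g (\<gamma> x) - g (\<gamma> t)) * (\<gamma> s - \<gamma> x)"]
          by (simp only: norm_minus_cancel)
        also have "\<dots> \<le> 2 * \<eta> * \<bar>V s - V x\<bar>"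
          using V_abs[OF xab sab] \<eta> by simp
        also have "\<dots> = \<bar>2 * \<eta> * V s - 2 * \<eta> * V x\<bar>"
          using \<eta> by (simp add: right_diff_distrib[symmetric] abs_mult)
        finally show ?thesis .
      qed
      then show "\<exists>d>0. \<forall>s\<in>{u..v}. \<bar>s - x\<bar> < d \<longrightarrow>
          norm (\<phi> s - \<phi> x) \<le> \<bar>2 * \<eta> * V s - 2 * \<eta> * V x\<bar>"
        using d(1) by blast
    qed (use uv in auto)
    then show ?thesis by (simp add: \<phi>_def algebra_simps)
  qed
  show "\<exists>\<delta>>0. \<forall>P. P tagged_division_of {a..b} \<and> (\<forall>(t, K)\<in>P. Sup K - Inf K < \<delta>) \<longrightarrow>
      norm ((\<Sum>(t, K)\<in>P. g (\<gamma> t) * (\<gamma> (Sup K) - \<gamma> (Inf K))) - (f (\<gamma> b) - f (\<gamma> a))) < \<epsilon>"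
  proof (intro exI[of _ \<delta>] conjI allI impI \<delta>(1), elim conjE)
    fix P assume P: "P tagged_division_of {a..b}" "\<forall>(t, K)\<in>P. Sup K - Inf K < \<delta>"
    have "(\<Sum>(t, K)\<in>P. g (\<gamma> t) * (\<gamma> (Sup K) - \<gamma> (Inf K))) - (f (\<gamma> b) - f (\<gamma> a))
        = (\<Sum>(t, K)\<in>P. g (\<gamma> t) * (\<gamma> (Sup K) - \<gamma> (Inf K)) - (f (\<gamma> (Sup K)) - f (\<gamma> (Inf K))))"
      unfolding additive_tagged_division_1[OF assms(2) P(1), of "\<lambda>t. f (\<gamma> t)", symmetric]
      by (simp add: sum_subtractf[symmetric] case_prod_unfold)
    also have "norm \<dots> \<le> (\<Sum>(t, K)\<in>P. 2 * \<eta> * V (Sup K) - 2 * \<eta> * V (Inf K))"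
    proof (rule sum_norm_le)
      fix x assume x: "x \<in> P"
      obtain t K where tK: "x = (t, K)" by (cases x)
      obtain u v where uv: "K = {u..v}" "u \<le> t" "t \<le> v" "a \<le> u" "v \<le> b"
        using tagged_division_of_realE[OF P(1)] x tK by metis
      have "v - u < \<delta>" using P(2) x tK uv by auto
      then show "norm (case x of (t, K) \<Rightarrow> g (\<gamma> t) * (\<gamma> (Sup K) - \<gamma> (Inf K)) - (f (\<gamma> (Sup K)) - f (\<gamma> (Inf K))))
          \<le> (case x of (t, K) \<Rightarrow> 2 * \<eta> * V (Sup K) - 2 * \<eta> * V (Inf K))"
        using piece[of u t v] uv by (simp add: tK)
    qed
    also have "\<dots> = 2 * \<eta> * V b - 2 * \<eta> * V a"
      by (rule additive_tagged_division_1[OF assms(2) P(1)])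
    also have "\<dots> < \<epsilon>" using \<eta>C by (simp add: C_def right_diff_distrib)
    finally show "norm ((\<Sum>(t, K)\<in>P. g (\<gamma> t) * (\<gamma> (Sup K) - \<gamma> (Inf K))) - (f (\<gamma> b) - f (\<gamma> a))) < \<epsilon>" .
  qed
qed

section \<open>From derivatives along paths to complex derivatives\<close>

text \<open>Pointwise regularity supplies arbitrary rectifiable paths; replacing them by arcs keeps
  the constant \<open>k\<close>. The case \<open>w = z\<close> is excluded because an injective path
  has distinct endpoints.\<close>

lemma pointwise_regular_arc_exists:
  assumes "pointwise_regular Y" "z \<in> Y"
  obtains k where "k > 0" "\<And>w. w \<in> Y \<Longrightarrow> w \<noteq> z \<Longrightarrow> \<exists>q. path_in Y q \<and> rectifiable q \<and> injective_path q \<and>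
      start_pt q = z \<and> end_pt q = w \<and> path_len q \<le> k * norm (w - z)"
proof -
  obtain k where k: "k > 0" "\<And>w. w \<in> Y \<Longrightarrow> \<exists>p. path_in Y p \<and> rectifiable p \<and>
        start_pt p = z \<and> end_pt p = w \<and> path_len p \<le> k * norm (z - w)"
    using assms unfolding pointwise_regular_def by blast
  show thesis
  proof (rule that[OF k(1)])
    fix w assume w: "w \<in> Y" "w \<noteq> z"
    obtain p where p: "path_in Y p" "rectifiable p" "start_pt p = z" "end_pt p = w"
      "path_len p \<le> k * norm (z - w)"
      using k(2)[OF w(1)] by blast
    have ne: "start_pt p \<noteq> end_pt p" using p w by simp
    obtain q where "path_in Y q" "rectifiable q" "injective_path q" "start_pt q = start_pt p"
      "end_pt q = end_pt p" "path_len q \<le> path_len p"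
      by (rule rectifiable_arc_exists[OF p(1,2) ne])
    then show "\<exists>q. path_in Y q \<and> rectifiable q \<and> injective_path q \<and>
        start_pt q = z \<and> end_pt q = w \<and> path_len q \<le> k * norm (w - z)"
      using p by (intro exI[of _ q]) (simp add: norm_minus_commute)
  qed
qed

text \<open>The interval \<open>{a..t}\<close> alone is a partial division. Short paths therefore
  stay in a small ball about their starting point, where \<open>g\<close> is nearly
  constant.\<close>

lemma path_in_dist_start_le:
  assumes "path_in X (a, b, \<gamma>)" "rectifiable (a, b, \<gamma>)" "t \<in> {a..b}"
  shows "norm (\<gamma> t - \<gamma> a) \<le> path_len (a, b, \<gamma>)"
proof -
  have "{a..t} = cbox a t" "cbox a t \<noteq> {}" using assms(3) by auto
  then have "{{a..t}} division_of {a..t}" by (metis division_of_self)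
  from path_len_ge_partial_division[OF assms(2) this] show ?thesis using assms(3) by auto
qed

lemma F_derivative_imp_has_derivative_piece:
  assumes reg: "pointwise_regular Y" and YX: "Y \<subseteq> X" and z: "z \<in> Y" and "L > 0"
    and \<F>: "\<And>p. path_in X p \<Longrightarrow> injective_path p \<Longrightarrow> rectifiable p \<Longrightarrow> path_len p \<le> L \<Longrightarrow> p \<in> \<F>"
    and fg: "F_derivative X \<F> f g"
  shows "(f has_field_derivative g z) (at z within Y)"
  unfolding has_field_derivative_def has_derivative_within_alt
proof (intro conjI allI impI)
  show "bounded_linear ((*) (g z))" by (rule bounded_linear_mult_right)
  fix e :: real assume e: "e > 0"
  obtain k where k: "k > 0" "\<And>w. w \<in> Y \<Longrightarrow> w \<noteq> z \<Longrightarrow> \<exists>q. path_in Y q \<and> rectifiable q \<and> injective_path q \<and>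
      start_pt q = z \<and> end_pt q = w \<and> path_len q \<le> k * norm (w - z)"
    using pointwise_regular_arc_exists[OF reg z] by blast
  \<comment> \<open>The oscillation of \<open>g\<close> will be multiplied by a length of up to
    \<open>k * norm (w - z)\<close>, so the tolerance is divided by \<open>k\<close>.\<close>
  have ek: "e / k > 0" using e k(1) by simp
  have "continuous_on X g" using fg by (simp add: F_derivative_def C_fun_def)
  then obtain d where d: "d > 0" "\<And>y. y \<in> X \<Longrightarrow> dist y z < d \<Longrightarrow> dist (g y) (g z) < e / k"
    using ek z YX unfolding continuous_on_iff by (metis subsetD)
  show "\<exists>d>0. \<forall>w\<in>Y. norm (w - z) < d \<longrightarrow> norm (f w - f z - g z * (w - z)) \<le> e * norm (w - z)"
  \<comment> \<open>With this radius the arc from \<open>z\<close> to \<open>w\<close> is shorter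
    than \<open>L\<close>, which puts it into \<open>\<F>\<close>, and shorter than
    \<open>d\<close>, which keeps \<open>g\<close> within \<open>e / k\<close> of \<open>g z\<close>
    along it.\<close>
  proof (intro exI[of _ "min L d / k"] conjI ballI impI)
    show "0 < min L d / k" using k(1) d(1) \<open>L > 0\<close> by simp
    fix w assume w: "w \<in> Y" "norm (w - z) < min L d / k"
    then have wk: "k * norm (w - z) < min L d"
      using k(1) by (simp add: pos_less_divide_eq mult.commute)
    show "norm (f w - f z - g z * (w - z)) \<le> e * norm (w - z)"
    proof (cases "w = z")
      case False
      then obtain q where q: "path_in Y q" "rectifiable q" "injective_path q"
          "start_pt q = z" "end_pt q = w" "path_len q \<le> k * norm (w - z)"
        using k(2) w(1) by blast
      obtain a b \<gamma> where ab: "q = (a, b, \<gamma>)" using prod_cases3 .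
      have \<gamma>: "a < b" "\<gamma> ` {a..b} \<subseteq> X" "\<gamma> a = z" "\<gamma> b = w"
        using q(1,4,5) YX by (auto simp: ab path_in_def start_pt_def end_pt_def)
      have "path_in X q" using q(1) YX by (auto simp: ab path_in_def)
      then have "q \<in> \<F>" using \<F> q wk by simp
      then have int: "has_path_integral g (f w - f z) (a, b, \<gamma>)"
        using fg q unfolding F_derivative_def ab[symmetric] by metis
      have rect: "rectifiable (a, b, \<gamma>)" using q(2) by (simp add: ab)
      have bound: "norm (g (\<gamma> t) - g z) \<le> e / k" if t: "t \<in> {a..b}" for t
      proof -
        have "norm (\<gamma> t - z) < d"
          using path_in_dist_start_le[OF q(1)[unfolded ab] rect t] q(6) wk \<gamma>(3) by (simp add: ab)
        moreover have "\<gamma> t \<in> X" using \<gamma>(2) t by blast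
        ultimately show ?thesis using d(2)[of "\<gamma> t"] by (simp add: dist_norm)
      qed
      have "norm (f w - f z - g z * (\<gamma> b - \<gamma> a)) \<le> e / k * path_len (a, b, \<gamma>)"
        by (rule has_path_integral_bound[OF int rect]) (use \<gamma>(1) ek bound in auto)
      also have "\<dots> \<le> e / k * (k * norm (w - z))"
        by (rule mult_left_mono) (use q(6) ek in \<open>auto simp: ab\<close>)
      also have "\<dots> = e * norm (w - z)" using k(1) by simp
      finally show ?thesis using \<gamma>(3,4) by simp
    qed simp
  qed
qed

text \<open>A limit within the union of two sets amounts to the limits within both; induction gives
  finite unions.\<close>

lemma has_field_derivative_within_Union:
  fixes f :: "'a::real_normed_field \<Rightarrow> 'a"
  assumes "finite \<Y>" "\<And>Y. Y \<in> \<Y> \<Longrightarrow> (f has_field_derivative D) (at z within Y)"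
  shows "(f has_field_derivative D) (at z within \<Union>\<Y>)"
  using assms
proof (induction \<Y> rule: finite_induct)
  case (insert Y \<Y>)
  then show ?case
    by (auto simp: has_field_derivative_iff Lim_within_Un)
qed (simp add: has_field_derivative_iff)

lemma F_derivative_imp_has_derivative:
  assumes "\<exists>\<Y>. finite \<Y> \<and> (\<forall>Y\<in>\<Y>. pointwise_regular Y) \<and> X = \<Union>\<Y>" and "L > 0"
    and "\<And>p. path_in X p \<Longrightarrow> injective_path p \<Longrightarrow> rectifiable p \<Longrightarrow> path_len p \<le> L \<Longrightarrow> p \<in> \<F>"
    and "F_derivative X \<F> f g" and "z \<in> X"
  shows "(f has_field_derivative g z) (at z within X)"
proof -
  obtain \<Y> where \<Y>: "finite \<Y>" "\<And>Y. Y \<in> \<Y> \<Longrightarrow> pointwise_regular Y" "X = \<Union>\<Y>"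
    using assms(1) by blast
  have "(f has_field_derivative g z) (at z within Y)" if Y: "Y \<in> \<Y>" for Y
  proof (cases "z \<in> Y")
    case True
    show ?thesis
      by (rule F_derivative_imp_has_derivative_piece[OF \<Y>(2)[OF Y] _ True assms(2-4)])
        (use Y \<Y>(3) in auto)
  next
    case False
    \<comment> \<open>A piece that misses \<open>z\<close> is closed, so \<open>z\<close> is not a
      limit point of it and differentiability within it is trivial.\<close>
    then have "at z within Y = bot"
      using \<Y>(2)[OF Y] compact_imp_closed islimpt_closure_open
      by (metis closed_limpt pointwise_regular_def trivial_limit_within)
    then show ?thesis by (simp add: has_field_derivative_iff)
  qed
  then show ?thesis unfolding \<Y>(3) by (rule has_field_derivative_within_Union[OF \<Y>(1)])
qed

section \<open>Derivatives on perfect sets and the inclusion of \<open>D1\<close> in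
  \<open>D1F\<close>\<close>

lemma perfect_at_within_neq_bot:
  assumes "perfect X" "z \<in> X"
  shows "at z within X \<noteq> bot"
  using assms by (simp add: perfect_def isolated_in_islimpt_iff trivial_limit_within)

text \<open>At a non-isolated point the filter is nontrivial, so limits are unique and
  \<open>Lim\<close> returns the actual derivative.\<close>

lemma cderiv_eqI:
  assumes "perfect X" "z \<in> X" "(f has_field_derivative D) (at z within X)"
  shows "cderiv X f z = D"
  unfolding cderiv_def
  by (rule tendsto_Lim) (use assms perfect_at_within_neq_bot in \<open>auto simp: has_field_derivative_iff\<close>)

lemma D1_has_derivative:
  assumes "perfect X" "f \<in> D1 X" "z \<in> X"
  shows "(f has_field_derivative cderiv X f z) (at z within X)"
proof -
  obtain D where D: "(f has_field_derivative D) (at z within X)"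
    using assms(2,3) by (auto simp: D1_def field_differentiable_def)
  then show ?thesis using cderiv_eqI[OF assms(1,3) D] by simp
qed

lemma D1I:
  assumes "perfect X" "f \<in> extensional X" "continuous_on X g"
    and "\<And>z. z \<in> X \<Longrightarrow> (f has_field_derivative g z) (at z within X)"
  shows "f \<in> D1 X"
proof -
  have "continuous_on X (cderiv X f) \<longleftrightarrow> continuous_on X g"
    by (rule continuous_on_cong) (use cderiv_eqI[OF assms(1) _ assms(4)] in auto)
  then show ?thesis
    using assms(2-4) by (auto simp: D1_def field_differentiable_def)
qed

lemma D1_continuous:
  assumes "f \<in> D1 X"
  shows "continuous_on X f" "continuous_on X (cderiv X f)"
proof -
  show "continuous_on X f"
    using assms field_differentiable_imp_continuous_at
    by (fastforce simp: D1_def continuous_on_eq_continuous_within)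
  show "continuous_on X (cderiv X f)"
    using assms by (simp add: D1_def)
qed

lemma D1_has_path_integral:
  assumes "perfect X" "f \<in> D1 X" "path_in X p" "rectifiable p"
  shows "has_path_integral (cderiv X f) (f (end_pt p) - f (start_pt p)) p"
proof -
  obtain a b \<gamma> where ab: "p = (a, b, \<gamma>)" using prod_cases3 .
  have "has_path_integral (cderiv X f) (f (\<gamma> b) - f (\<gamma> a)) (a, b, \<gamma>)"
    by (rule path_integral_of_derivative[where X = X])
      (use assms D1_has_derivative[OF assms(1,2)] in \<open>auto simp: ab path_in_def D1_def\<close>)
  then show ?thesis by (simp add: ab start_pt_def end_pt_def)
qed

text \<open>Needed because \<open>cderiv X f\<close> is not \<open>undefined\<close> outside
  \<open>X\<close> in general, whereas members of \<open>C_fun X\<close> are: its restriction to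
  \<open>X\<close> serves as the derivative along \<open>\<F>\<close>.\<close>

lemma has_path_integral_cong:
  assumes "path_in X p" "\<And>z. z \<in> X \<Longrightarrow> g z = h z"
  shows "has_path_integral g I p \<longleftrightarrow> has_path_integral h I p"
proof -
  obtain a b \<gamma> where ab: "p = (a, b, \<gamma>)" using prod_cases3 .
  have "(\<Sum>(t, K)\<in>P. g (\<gamma> t) * (\<gamma> (Sup K) - \<gamma> (Inf K))) = (\<Sum>(t, K)\<in>P. h (\<gamma> t) * (\<gamma> (Sup K) - \<gamma> (Inf K)))"
    if P: "P tagged_division_of {a..b}" for P
  proof (rule sum.cong[OF refl], clarify)
    fix t K assume "(t, K) \<in> P"
    then have "t \<in> {a..b}" using tagged_division_ofD(2,3)[OF P] by blast
    then have "\<gamma> t \<in> X" using assms(1) by (auto simp: ab path_in_def)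
    then show "g (\<gamma> t) * (\<gamma> (Sup K) - \<gamma> (Inf K)) = h (\<gamma> t) * (\<gamma> (Sup K) - \<gamma> (Inf K))"
      using assms(2) by simp
  qed
  then show ?thesis
    by (simp add: ab has_path_integral_def cong: conj_cong imp_cong)
qed

lemma D1_imp_D1F:
  assumes "perfect X" "useful X \<F>" "f \<in> D1 X"
  shows "f \<in> D1F X \<F>"
proof -
  let ?g = "restrict (cderiv X f) X"
  have cont: "continuous_on X ?g"
    using assms(3) continuous_on_cong[of X X ?g "cderiv X f"] by (simp add: D1_def)
  have "has_path_integral ?g (f (end_pt p) - f (start_pt p)) p" if p: "p \<in> \<F>" for p
  proof -
    have p': "path_in X p" "rectifiable p" using assms(2) p by (auto simp: useful_def)
    show ?thesis
      using D1_has_path_integral[OF assms(1,3) p'] has_path_integral_cong[OF p'(1), of ?g "cderiv X f"]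
      by simp
  qed
  moreover have "f \<in> C_fun X" "?g \<in> C_fun X"
    using D1_continuous(1)[OF assms(3)] assms(3) cont by (simp_all add: C_fun_def D1_def)
  ultimately show ?thesis
    unfolding D1F_def F_derivative_def by blast
qed

section \<open>Supremum norms and the metric on \<open>D1\<close>\<close>

lemma norm_le_sup_norm:
  assumes "compact X" "continuous_on X f" "z \<in> X"
  shows "norm (f z) \<le> sup_norm X f"
  unfolding sup_norm_def
proof (rule cSUP_upper[OF assms(3)])
  have "compact ((\<lambda>z. norm (f z)) ` X)"
    by (intro compact_continuous_image continuous_intros assms)
  then show "bdd_above ((\<lambda>z. norm (f z)) ` X)"
    by (intro bounded_imp_bdd_above compact_imp_bounded)
qed

lemma sup_norm_le:
  assumes "X \<noteq> {}" "\<And>z. z \<in> X \<Longrightarrow> norm (f z) \<le> B"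
  shows "sup_norm X f \<le> B"
  unfolding sup_norm_def by (rule cSUP_least[OF assms])

text \<open>The restricted difference agrees with the plain one on \<open>X\<close>, so it has the
  same derivative within \<open>X\<close>, and differentiation is linear there. The metric axioms
  and completeness then reduce to supremum norms.\<close>

lemma D1_dist_eq:
  assumes "perfect X" "f \<in> D1 X" "g \<in> D1 X"
  shows "D1_dist X f g = sup_norm X (\<lambda>z. f z - g z) + sup_norm X (\<lambda>z. cderiv X f z - cderiv X g z)"
proof -
  have "cderiv X (\<lambda>z\<in>X. f z - g z) z = cderiv X f z - cderiv X g z" if z: "z \<in> X" for z
  proof (rule cderiv_eqI[OF assms(1) z])
    have "((\<lambda>z. f z - g z) has_field_derivative cderiv X f z - cderiv X g z) (at z within X)"
      by (intro DERIV_diff D1_has_derivative assms z)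
    then show "((\<lambda>z\<in>X. f z - g z) has_field_derivative cderiv X f z - cderiv X g z) (at z within X)"
      by (rule has_field_derivative_transform_within[OF _ zero_less_one z]) simp
  qed
  then show ?thesis
    using assms(2,3) by (simp add: D1_dist_def D1_norm_def sup_norm_def cong: SUP_cong_simp)
qed

lemma sup_norm_nonneg:
  assumes "compact X" "X \<noteq> {}" "continuous_on X f"
  shows "0 \<le> sup_norm X f"
proof -
  obtain z where "z \<in> X" using assms(2) by blast
  then show ?thesis using norm_le_sup_norm[OF assms(1,3)] norm_ge_zero order_trans by blast
qed

lemma sup_norm_diff_triangle:
  assumes "compact X" "X \<noteq> {}" "continuous_on X f" "continuous_on X g" "continuous_on X h"
  shows "sup_norm X (\<lambda>z. f z - h z) \<le> sup_norm X (\<lambda>z. f z - g z) + sup_norm X (\<lambda>z. g z - h z)"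
proof (rule sup_norm_le[OF assms(2)])
  fix z assume z: "z \<in> X"
  have "norm (f z - h z) \<le> norm (f z - g z) + norm (g z - h z)"
    using norm_triangle_ineq[of "f z - g z" "g z - h z"] by simp
  also have "\<dots> \<le> sup_norm X (\<lambda>z. f z - g z) + sup_norm X (\<lambda>z. g z - h z)"
    using norm_le_sup_norm[OF assms(1) continuous_on_diff[OF assms(3,4)] z]
      norm_le_sup_norm[OF assms(1) continuous_on_diff[OF assms(4,5)] z] by (rule add_mono)
  finally show "norm (f z - h z) \<le> sup_norm X (\<lambda>z. f z - g z) + sup_norm X (\<lambda>z. g z - h z)" .
qed

text \<open>Each of the two summands of the distance is nonnegative, so either one is bounded by the
  sum. Convergence in the metric thereby controls functions and derivatives uniformly.\<close>

lemma D1_dist_ge: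
  assumes "compact X" "perfect X" "f \<in> D1 X" "g \<in> D1 X" "z \<in> X"
  shows "norm (f z - g z) \<le> D1_dist X f g"
    and "norm (cderiv X f z - cderiv X g z) \<le> D1_dist X f g"
proof -
  have ne: "X \<noteq> {}" using assms(5) by blast
  have f: "continuous_on X (\<lambda>z. f z - g z)"
    and f': "continuous_on X (\<lambda>z. cderiv X f z - cderiv X g z)"
    by (intro continuous_on_diff D1_continuous assms)+
  show "norm (f z - g z) \<le> D1_dist X f g"
    and "norm (cderiv X f z - cderiv X g z) \<le> D1_dist X f g"
    unfolding D1_dist_eq[OF assms(2-4)]
    using norm_le_sup_norm[OF assms(1) f assms(5)] sup_norm_nonneg[OF assms(1) ne f]
      norm_le_sup_norm[OF assms(1) f' assms(5)] sup_norm_nonneg[OF assms(1) ne f'] by linarith+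
qed

lemma Metric_space_D1:
  assumes "compact X" "perfect X"
  shows "Metric_space (D1 X) (D1_dist X)"
proof
  have ne: "X \<noteq> {}" using assms(2) by (simp add: perfect_def)
  fix f g
  show "0 \<le> D1_dist X f g"
  proof (cases "f \<in> D1 X \<and> g \<in> D1 X")
    case True
    then show ?thesis
      using D1_dist_ge(1)[OF assms] ne norm_ge_zero order_trans by (metis ex_in_conv)
  qed (auto simp: D1_dist_def)
  show "D1_dist X f g = D1_dist X g f"
  proof (cases "f \<in> D1 X \<and> g \<in> D1 X")
    case True
    then show ?thesis
      by (simp add: D1_dist_eq[OF assms(2)] sup_norm_def norm_minus_commute)
  qed (auto simp: D1_dist_def)
  assume f: "f \<in> D1 X" and g: "g \<in> D1 X"
  show "D1_dist X f g = 0 \<longleftrightarrow> f = g"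
  proof
    assume "D1_dist X f g = 0"
    then have "f z = g z" if "z \<in> X" for z
      using D1_dist_ge(1)[OF assms f g that] by simp
    then show "f = g"
      \<comment> \<open>Agreement on \<open>X\<close> yields equality since both functions are
        extensional.\<close>
      using f g by (intro extensionalityI[of f X g]) (auto simp: D1_def)
  next
    assume "f = g"
    then show "D1_dist X f g = 0"
      using ne by (simp add: D1_dist_eq[OF assms(2) g g] sup_norm_def)
  qed
  fix h assume h: "h \<in> D1 X"
  show "D1_dist X f h \<le> D1_dist X f g + D1_dist X g h"
    unfolding D1_dist_eq[OF assms(2) f h] D1_dist_eq[OF assms(2) f g] D1_dist_eq[OF assms(2) g h]
    using sup_norm_diff_triangle[OF assms(1) ne D1_continuous(1)[OF f] D1_continuous(1)[OF g] D1_continuous(1)[OF h]]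
      sup_norm_diff_triangle[OF assms(1) ne D1_continuous(2)[OF f] D1_continuous(2)[OF g] D1_continuous(2)[OF h]]
    by linarith
qed

section \<open>Completeness and the final result\<close>

text \<open>For a Cauchy sequence the functions and their derivatives converge uniformly to some
  \<open>f\<close> and \<open>g\<close>. The integral identities along \<open>\<F>\<close> pass to
  the limit, so \<open>g\<close> is an \<open>\<F>\<close>-derivative of \<open>f\<close>, and
  \<open>deriv\<close> turns this into differentiability. The geometry of \<open>X\<close> enters
  through \<open>deriv\<close>.\<close>

lemma mcomplete_D1:
  assumes "compact X" "perfect X"
    and \<F>: "\<And>p. p \<in> \<F> \<Longrightarrow> path_in X p \<and> rectifiable p"
    and deriv: "\<And>f g z. F_derivative X \<F> f g \<Longrightarrow> z \<in> X \<Longrightarrow> (f has_field_derivative g z) (at z within X)"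
  shows "Metric_space.mcomplete (D1 X) (D1_dist X)"
proof -
  interpret Metric_space "D1 X" "D1_dist X" by (rule Metric_space_D1[OF assms(1,2)])
  have ne: "X \<noteq> {}" using assms(2) by (simp add: perfect_def)
  show ?thesis
    unfolding mcomplete_def
  proof (intro allI impI)
    fix \<sigma> assume \<sigma>_Cauchy: "MCauchy \<sigma>"
    have \<sigma>: "\<sigma> n \<in> D1 X" for n
      using \<sigma>_Cauchy by (auto simp: MCauchy_def)
    have cauchy: "\<exists>N. \<forall>z\<in>X. \<forall>m\<ge>N. \<forall>n\<ge>N. dist (\<sigma> m z) (\<sigma> n z) < \<epsilon> \<and>
        dist (cderiv X (\<sigma> m) z) (cderiv X (\<sigma> n) z) < \<epsilon>" if \<epsilon>: "\<epsilon> > 0" for \<epsilon>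
    proof -
      obtain N where N: "\<And>m n. N \<le> m \<Longrightarrow> N \<le> n \<Longrightarrow> D1_dist X (\<sigma> m) (\<sigma> n) < \<epsilon>"
        using \<sigma>_Cauchy \<epsilon> unfolding MCauchy_def by metis
      show ?thesis
      proof (intro exI[of _ N] ballI allI impI conjI)
        fix z m n assume z: "z \<in> X" and mn: "N \<le> m" "N \<le> n"
        show "dist (\<sigma> m z) (\<sigma> n z) < \<epsilon>"
          using D1_dist_ge(1)[OF assms(1,2) \<sigma>[of m] \<sigma>[of n] z] N[OF mn] by (simp add: dist_norm)
        show "dist (cderiv X (\<sigma> m) z) (cderiv X (\<sigma> n) z) < \<epsilon>"
          using D1_dist_ge(2)[OF assms(1,2) \<sigma>[of m] \<sigma>[of n] z] N[OF mn] by (simp add: dist_norm)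
      qed
    qed
    have "uniformly_Cauchy_on X \<sigma>" "uniformly_Cauchy_on X (\<lambda>n. cderiv X (\<sigma> n))"
      unfolding uniformly_Cauchy_on_def using cauchy by blast+
    then obtain f0 g0 where lim: "uniform_limit X \<sigma> f0 sequentially"
        "uniform_limit X (\<lambda>n. cderiv X (\<sigma> n)) g0 sequentially"
      unfolding uniformly_convergent_eq_Cauchy[symmetric] uniformly_convergent_on_def by blast
    \<comment> \<open>Uniform limits on \<open>X\<close> are determined only on \<open>X\<close>;
      restricting gives members of the function spaces.\<close>
    define f where "f = restrict f0 X"
    define g where "g = restrict g0 X"
    have lim_f: "uniform_limit X \<sigma> f sequentially"
      using lim(1) uniform_limit_cong'[of X \<sigma> \<sigma> f f0] by (simp add: f_def)
    have lim_g: "uniform_limit X (\<lambda>n. cderiv X (\<sigma> n)) g sequentially"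
      using lim(2) uniform_limit_cong'[of X "\<lambda>n. cderiv X (\<sigma> n)" "\<lambda>n. cderiv X (\<sigma> n)" g g0]
      by (simp add: g_def)
    have cont_g: "continuous_on X g"
      by (rule uniform_limit_theorem[OF _ lim_g]) (simp_all add: D1_continuous[OF \<sigma>])
    have "has_path_integral g (f (end_pt p) - f (start_pt p)) p" if p: "p \<in> \<F>" for p
    proof -
      obtain a b \<gamma> where ab: "p = (a, b, \<gamma>)" using prod_cases3 .
      have \<gamma>: "a < b" "\<gamma> ` {a..b} \<subseteq> X" "rectifiable (a, b, \<gamma>)"
        using \<F>[OF p] by (auto simp: ab path_in_def)
      have ends: "\<gamma> a \<in> X" "\<gamma> b \<in> X" using \<gamma>(1,2) by auto
      have lim_I: "(\<lambda>n. \<sigma> n (\<gamma> b) - \<sigma> n (\<gamma> a)) \<longlonglongrightarrow> f (\<gamma> b) - f (\<gamma> a)"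
        by (rule tendsto_diff[OF tendsto_uniform_limitI[OF lim_f ends(2)] tendsto_uniform_limitI[OF lim_f ends(1)]])
      have int: "has_path_integral (cderiv X (\<sigma> n)) (\<sigma> n (\<gamma> b) - \<sigma> n (\<gamma> a)) (a, b, \<gamma>)" for n
        using D1_has_path_integral[OF assms(2) \<sigma>[of n], of p] \<F>[OF p] by (simp add: ab start_pt_def end_pt_def)
      have "has_path_integral g (f (\<gamma> b) - f (\<gamma> a)) (a, b, \<gamma>)"
        by (rule has_path_integral_uniform_limit[OF int \<gamma>(3) less_imp_le[OF \<gamma>(1)]
              uniform_limit_on_subset[OF lim_g \<gamma>(2)] lim_I])
      then show ?thesis by (simp add: ab start_pt_def end_pt_def)
    qed
    then have "F_derivative X \<F> f g"
      using cont_g by (auto simp: F_derivative_def C_fun_def g_def)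
    from deriv[OF this] have f_deriv: "(f has_field_derivative g z) (at z within X)" if "z \<in> X" for z
      using that by blast
    have f: "f \<in> D1 X"
      by (rule D1I[OF assms(2) _ cont_g f_deriv]) (simp add: f_def)
    have "\<exists>N. \<forall>n\<ge>N. D1_dist X (\<sigma> n) f < \<epsilon>" if \<epsilon>: "\<epsilon> > 0" for \<epsilon>
    proof -
      \<comment> \<open>Suprema turn strict bounds into weak ones; thirds leave
        \<open>2 * \<epsilon> / 3\<close>, still strictly below \<open>\<epsilon>\<close>.\<close>
      have "\<forall>\<^sub>F n in sequentially. (\<forall>z\<in>X. dist (\<sigma> n z) (f z) < \<epsilon> / 3) \<and>
          (\<forall>z\<in>X. dist (cderiv X (\<sigma> n) z) (g z) < \<epsilon> / 3)"
        by (rule eventually_conj[OF uniform_limitD[OF lim_f] uniform_limitD[OF lim_g]]) (use \<epsilon> in simp_all)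
      then obtain N where N: "\<And>n z. n \<ge> N \<Longrightarrow> z \<in> X \<Longrightarrow> dist (\<sigma> n z) (f z) < \<epsilon> / 3"
          "\<And>n z. n \<ge> N \<Longrightarrow> z \<in> X \<Longrightarrow> dist (cderiv X (\<sigma> n) z) (g z) < \<epsilon> / 3"
        unfolding eventually_sequentially by blast
      have "D1_dist X (\<sigma> n) f < \<epsilon>" if n: "n \<ge> N" for n
      proof -
        have "sup_norm X (\<lambda>z. \<sigma> n z - f z) \<le> \<epsilon> / 3"
        proof (rule sup_norm_le[OF ne])
          fix z assume "z \<in> X"
          from N(1)[OF n this] show "norm (\<sigma> n z - f z) \<le> \<epsilon> / 3"
            unfolding dist_norm by (rule less_imp_le)
        qed
        moreover have "sup_norm X (\<lambda>z. cderiv X (\<sigma> n) z - cderiv X f z) \<le> \<epsilon> / 3"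
        proof (rule sup_norm_le[OF ne])
          fix z assume z: "z \<in> X"
          from N(2)[OF n z] show "norm (cderiv X (\<sigma> n) z - cderiv X f z) \<le> \<epsilon> / 3"
            unfolding dist_norm cderiv_eqI[OF assms(2) z f_deriv[OF z]] by (rule less_imp_le)
        qed
        ultimately have "D1_dist X (\<sigma> n) f \<le> \<epsilon> / 3 + \<epsilon> / 3"
          unfolding D1_dist_eq[OF assms(2) \<sigma>[of n] f] by (rule add_mono)
        then show ?thesis using \<epsilon> by simp
      qed
      then show ?thesis by blast
    qed
    then have "limitin mtopology \<sigma> f sequentially"
      by (simp add: limit_metric_sequentially f \<sigma>)
    then show "\<exists>f. limitin mtopology \<sigma> f sequentially"
      by (rule exI[of "\<lambda>f. limitin mtopology \<sigma> f sequentially" f])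
  qed
qed

theorem theorem5p1:
  fixes X :: "complex set" and \<F> :: "cpath set" and L :: real
  assumes "compact X" and "perfect X"
    and "\<exists>\<Y>. finite \<Y> \<and> (\<forall>Y\<in>\<Y>. pointwise_regular Y) \<and> X = \<Union>\<Y>"
    and "L > 0"
    and "useful X \<F>"
    and "\<And>p. path_in X p \<Longrightarrow> injective_path p \<Longrightarrow> rectifiable p \<Longrightarrow> path_len p \<le> L \<Longrightarrow> p \<in> \<F>"
  shows "D1 X = D1F X \<F> \<and>
         Metric_space (D1 X) (D1_dist X) \<and> Metric_space.mcomplete (D1 X) (D1_dist X)"
proof (intro conjI equalityI subsetI)
  have deriv: "(f has_field_derivative g z) (at z within X)" if "F_derivative X \<F> f g" "z \<in> X" for f g z
    using F_derivative_imp_has_derivative[OF assms(3,4,6) that] .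
  show "f \<in> D1F X \<F>" if "f \<in> D1 X" for f
    by (rule D1_imp_D1F[OF assms(2,5) that])
  show "f \<in> D1 X" if f: "f \<in> D1F X \<F>" for f
  proof -
    obtain g where g: "F_derivative X \<F> f g" "f \<in> C_fun X" using f by (auto simp: D1F_def)
    show ?thesis
      by (rule D1I[OF assms(2) _ _ deriv[OF g(1)]]) (use g in \<open>auto simp: C_fun_def F_derivative_def\<close>)
  qed
  show "Metric_space (D1 X) (D1_dist X)" by (rule Metric_space_D1[OF assms(1,2)])
  show "Metric_space.mcomplete (D1 X) (D1_dist X)"
  proof (rule mcomplete_D1[OF assms(1,2)])
    show "path_in X p \<and> rectifiable p" if "p \<in> \<F>" for p
      using assms(5) that by (simp add: useful_def)
    show "(f has_field_derivative g z) (at z within X)" if "F_derivative X \<F> f g" "z \<in> X" for f g z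
      using deriv[OF that] .
  qed
qed

end
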